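(* Let $Q=\{q(k)\}_{k\ge1}$ be a strictly increasing sequence of positive integers with $q(k+1)/q(k)\to\infty$ as $k\to\infty$. Then $\Lambda=\mathbb{Z}^+\cup(-Q)$, where $\mathbb{Z}^+=\{0,1,2,\dots\}$ and $-Q=\{-q(k):k\ge1\}$, is not a Menshov spectrum.
   Context: $\mathbb{T}=\mathbb{R}/2\pi\mathbb{Z}$ with Lebesgue measure; $L^0(\mathbb{T})$ is the space of measurable, almost everywhere finite functions on $\mathbb{T}$. A set $\Lambda\subset\mathbb{Z}$ is called a Menshov spectrum if for every $f\in L^0(\mathbb{T})$ there exist coefficients $c(n)$, $n\in\mathbb{Z}$, with $c(n)=0$ for all $n\notin\Lambda$, such that the trigonometric series $\sum_{n}c(n)e^{int}$ converges to $f(t)$ for almost every $t$ (convergence of the symmetric partial sums $\sum_{|n|\le N}c(n)e^{int}$). *)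

theory Defs
  imports "HOL-Analysis.Analysis"
begin

text \<open>The circle T = R/2piZ is represented by the interval [0, 2pi] with Lebesgue
measure (the endpoints form a null set). L^0(T) consists of the complex-valued
Lebesgue measurable functions on it (complex values are automatically finite).
A set Lambda of integers is a Menshov spectrum if every such f is the a.e. limit
of the symmetric partial sums of a trigonometric series with spectrum in Lambda.\<close>

definition menshov_spectrum :: "int set \<Rightarrow> bool" where
  "menshov_spectrum \<Lambda> \<longleftrightarrow>
     (\<forall>f :: real \<Rightarrow> complex. f \<in> borel_measurable (lebesgue_on {0..2*pi}) \<longrightarrow>
        (\<exists>c :: int \<Rightarrow> complex. (\<forall>n. n \<notin> \<Lambda> \<longrightarrow> c n = 0) \<and>
           (AE t in lebesgue_on {0..2*pi}.
              (\<lambda>N::nat. \<Sum>n\<in>{- int N..int N}. c n * exp (\<i> * of_int n * of_real t))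
                \<longlonglongrightarrow> f t)))"

end

theory Submission
  imports Defs "HOL-Complex_Analysis.Complex_Analysis"
begin

text \<open>
Write \<open>p j = q j\<close> for the negative frequencies and take
\<open>f t = (\<Sum>i. \<alpha> i * cis (- m i * t))\<close>, where \<open>m i\<close> lies deep inside the gap between
\<open>p (n i)\<close> and \<open>p (n i + 1)\<close> and \<open>\<alpha> (i + 1) = \<alpha> i ^ 4\<close>. Suppose that partial sums
\<open>S N = P + R\<close> (\<open>P\<close> an analytic polynomial, \<open>R\<close> the lacunary anti-analytic part) converge to \<open>f\<close>
almost everywhere. Outside a set of small measure they are bounded by some \<open>K\<close>. Fix \<open>i\<close> large.

Let \<open>\<gamma>\<close> be a curve in the closed disc that touches the circle at finitely many good points and
has small tents over the gaps. Abel summation from the nearest good point bounds the harmonic extension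
\<open>u = P + R\<close> on \<open>\<gamma>\<close> by a multiple of \<open>K\<close>. As \<open>P * cnj R\<close> is analytic and vanishes at 0,
\<open>\<integral>\<bar>R\<bar>\<^sup>2 = Re \<integral> u * cnj R\<close> along \<open>\<gamma>\<close>, so \<open>R\<close> is bounded in \<open>L\<^sup>2\<close>, and by
lacunarity so are its coefficients in \<open>l\<^sup>2\<close>.

Since \<open>p (j + 1) / p j \<rightarrow> \<infinity>\<close>, there is a translation by \<open>\<theta>\<close> that nearly fixes all
\<open>cis (- p j * t)\<close> but flips the sign of \<open>cis (- m i * t)\<close>. The increment \<open>\<Delta>\<close> by \<open>\<theta>\<close>
makes \<open>z ^ m i * \<Delta>P\<close> close to the constant \<open>-2 * \<alpha> i\<close> on the good part of \<open>\<gamma>\<close>, with an error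
\<open>O(K * \<alpha> i ^ 3)\<close>. Multiply by an analytic function \<open>W\<close> with \<open>\<bar>W\<bar> \<le> 1\<close> that is at most \<open>x\<^sup>2\<close> on the
bad part of \<open>\<gamma>\<close> and at least \<open>x\<close> at 0. As \<open>z ^ m i * \<Delta>P\<close> vanishes at 0, Cauchy's formula gives
\<open>\<alpha> i * x \<le> C * (\<alpha> i ^ 3 + x\<^sup>2)\<close>; with \<open>x\<close> a small multiple of \<open>\<alpha> i\<close> this fails for large \<open>i\<close>.
\<close>

subsection \<open>Trigonometric sums\<close>

lemma cis_has_vector_derivative:
  "((\<lambda>t. cis (c * t)) has_vector_derivative (\<i> * of_real c * cis (c * t))) (at t within S)"
proof -
  have "((\<lambda>z. exp (\<i> * of_real c * z)) has_field_derivative \<i> * of_real c * exp (\<i> * of_real c * of_real t))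
      (at (of_real t))"
    by (auto intro!: derivative_eq_intros)
  from has_vector_derivative_real_field[OF this]
  show ?thesis
    by (simp add: cis_conv_exp mult.assoc has_vector_derivative_at_within)
qed

lemma cmod_cis_minus_1_le: "cmod (cis x - 1) \<le> \<bar>x\<bar>"
  using dist_exp_i_1[of x] abs_sin_le_one abs_sin_x_le_abs_x[of "x / 2"] by (simp add: cis_conv_exp)

lemma cmod_cis_diff_le: "cmod (cis x - cis y) \<le> \<bar>x - y\<bar>"
proof -
  have "cis x - cis y = cis y * (cis (x - y) - 1)"
    by (simp add: right_diff_distrib cis_mult)
  then show ?thesis using cmod_cis_minus_1_le[of "x - y"] by (simp add: norm_mult)
qed

section \<open>Orthogonality and second and fourth moments of trigonometric sums\<close>

lemma has_integral_cis_period: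
  fixes k :: int
  shows "((\<lambda>t. cis (of_int k * t)) has_integral (if k = 0 then 2 * pi else 0)) {x..x + 2 * pi}"
proof (cases "k = 0")
  case True
  have "((\<lambda>t::real. 1 :: complex) has_integral of_real (2 * pi)) {x..x + 2 * pi}"
    using has_integral_const_real[of "1::complex" x "x + 2 * pi"] by (simp add: scaleR_conv_of_real)
  then show ?thesis using True by (simp add: scaleR_conv_of_real)
next
  case False
  let ?F = "\<lambda>t. cis (of_int k * t) / (\<i> * of_int k)"
  have "((\<lambda>t. cis (of_int k * t)) has_integral (?F (x + 2 * pi) - ?F x)) {x..x + 2 * pi}"
  proof (rule fundamental_theorem_of_calculus)
    fix t assume "t \<in> {x..x + 2 * pi}"
    have "(?F has_vector_derivative (\<i> * of_real (of_int k) * cis (of_int k * t)) / (\<i> * of_int k))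
      (at t within {x..x + 2 * pi})"
      by (intro has_vector_derivative_divide cis_has_vector_derivative)
    then show "(?F has_vector_derivative cis (of_int k * t)) (at t within {x..x + 2 * pi})"
      using False by (simp add: field_simps)
  qed simp
  moreover have "cis (of_int k * (x + 2 * pi)) = cis (of_int k * x)"
  proof -
    have "cis (of_int k * (x + 2 * pi)) = cis (of_int k * x) * cis (2 * pi * of_int k)"
      by (simp add: cis_mult algebra_simps)
    then show ?thesis by (simp )
  qed
  ultimately show ?thesis using False by simp
qed

text \<open>Frequencies may repeat: all pairs with equal frequency survive the integration. The
  fourth moment needs this generality, because there the frequencies are sums of two others.\<close>

lemma integral_trig_sum_squared:
  fixes \<phi> :: "'a \<Rightarrow> int" and \<alpha> :: "'a \<Rightarrow> complex"
  assumes "finite I"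
  shows "((\<lambda>t. complex_of_real ((cmod (\<Sum>x\<in>I. \<alpha> x * cis (of_int (\<phi> x) * t)))\<^sup>2)) has_integral
     2 * pi * (\<Sum>x\<in>I. \<Sum>y\<in>I. if \<phi> x = \<phi> y then \<alpha> x * cnj (\<alpha> y) else 0)) {x0..x0 + 2 * pi}"
proof -
  have eq: "complex_of_real ((cmod (\<Sum>x\<in>I. \<alpha> x * cis (of_int (\<phi> x) * t)))\<^sup>2) =
     (\<Sum>x\<in>I. \<Sum>y\<in>I. \<alpha> x * cnj (\<alpha> y) * cis (of_int (\<phi> x - \<phi> y) * t))" for t
    unfolding complex_norm_square cnj_sum sum_product
    by (intro sum.cong refl) (simp add: cis_cnj left_diff_distrib cis_divide[symmetric] divide_inverse)
  have "((\<lambda>t. \<Sum>x\<in>I. \<Sum>y\<in>I. \<alpha> x * cnj (\<alpha> y) * cis (of_int (\<phi> x - \<phi> y) * t)) has_integral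
     (\<Sum>x\<in>I. \<Sum>y\<in>I. \<alpha> x * cnj (\<alpha> y) * (if \<phi> x - \<phi> y = 0 then 2 * pi else 0))) {x0..x0 + 2 * pi}"
    by (intro has_integral_sum assms has_integral_mult_right) (use has_integral_cis_period[of "\<phi> _ - \<phi> _" x0] in \<open>simp split: if_splits\<close>)
  moreover have "(\<Sum>x\<in>I. \<Sum>y\<in>I. \<alpha> x * cnj (\<alpha> y) * (if \<phi> x - \<phi> y = 0 then 2 * pi else 0)) =
    2 * pi * (\<Sum>x\<in>I. \<Sum>y\<in>I. if \<phi> x = \<phi> y then \<alpha> x * cnj (\<alpha> y) else 0)"
    by (auto simp: sum_distrib_left intro!: sum.cong)
  ultimately show ?thesis by (simp only: eq)
qed

lemma has_integral_parseval:
  fixes \<phi> :: "'a \<Rightarrow> int" and \<alpha> :: "'a \<Rightarrow> complex"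
  assumes "finite I" "inj_on \<phi> I"
  shows "((\<lambda>t. (cmod (\<Sum>x\<in>I. \<alpha> x * cis (of_int (\<phi> x) * t)))\<^sup>2) has_integral
     2 * pi * (\<Sum>x\<in>I. (cmod (\<alpha> x))\<^sup>2)) {x0..x0 + 2 * pi}"
proof -
  have "(\<Sum>x\<in>I. \<Sum>y\<in>I. if \<phi> x = \<phi> y then \<alpha> x * cnj (\<alpha> y) else 0) =
      (\<Sum>x\<in>I. \<Sum>y\<in>I. if x = y then \<alpha> x * cnj (\<alpha> x) else 0)"
    using assms(2) by (intro sum.cong) (auto simp: inj_on_def)
  also have "\<dots> = (\<Sum>x\<in>I. complex_of_real ((cmod (\<alpha> x))\<^sup>2))"
    using assms(1) by (simp add: complex_norm_square flip: of_real_power)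
  finally have "(\<Sum>x\<in>I. \<Sum>y\<in>I. if \<phi> x = \<phi> y then \<alpha> x * cnj (\<alpha> y) else 0) =
      complex_of_real (\<Sum>x\<in>I. (cmod (\<alpha> x))\<^sup>2)" by simp
  with has_integral_Re[OF integral_trig_sum_squared[OF assms(1), of \<alpha> \<phi> x0]]
  show ?thesis by simp
qed

text \<open>Parseval with collisions: a product of two coefficients of equal frequency is at most
  the mean of their squares, and by symmetry each square is counted at most \<open>M\<close>
  times.\<close>

lemma integral_trig_sum_squared_le:
  fixes \<phi> :: "'a \<Rightarrow> int" and \<alpha> :: "'a \<Rightarrow> complex"
  assumes fin: "finite I" and fib: "\<And>x. x \<in> I \<Longrightarrow> card {y\<in>I. \<phi> x = \<phi> y} \<le> M"
  shows "integral {x0..x0 + 2 * pi} (\<lambda>t. (cmod (\<Sum>x\<in>I. \<alpha> x * cis (of_int (\<phi> x) * t)))\<^sup>2)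
     \<le> 2 * pi * (M * (\<Sum>x\<in>I. (cmod (\<alpha> x))\<^sup>2))"
proof -
  let ?n = "\<lambda>x. (cmod (\<alpha> x))\<^sup>2"
  have sym: "(\<Sum>x\<in>I. \<Sum>y\<in>I. if \<phi> x = \<phi> y then ?n y else 0) = (\<Sum>x\<in>I. \<Sum>y\<in>I. if \<phi> x = \<phi> y then ?n x else 0)"
    by (subst sum.swap) (intro sum.cong refl, auto)
  have "Re (\<Sum>x\<in>I. \<Sum>y\<in>I. if \<phi> x = \<phi> y then \<alpha> x * cnj (\<alpha> y) else 0)
      = (\<Sum>x\<in>I. \<Sum>y\<in>I. if \<phi> x = \<phi> y then Re (\<alpha> x * cnj (\<alpha> y)) else 0)"
    by (auto simp: Re_sum intro!: sum.cong)
  also have "\<dots> \<le> (\<Sum>x\<in>I. \<Sum>y\<in>I. if \<phi> x = \<phi> y then (?n x + ?n y) / 2 else 0)"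
  proof (intro sum_mono)
    fix x y
    have "Re (\<alpha> x * cnj (\<alpha> y)) \<le> cmod (\<alpha> x) * cmod (\<alpha> y)"
      using complex_Re_le_cmod[of "\<alpha> x * cnj (\<alpha> y)"] by (simp add: norm_mult)
    also have "\<dots> \<le> (?n x + ?n y) / 2"
      using sum_squares_bound[of "cmod (\<alpha> x)" "cmod (\<alpha> y)"] by (simp add: field_simps)
    finally show "(if \<phi> x = \<phi> y then Re (\<alpha> x * cnj (\<alpha> y)) else 0)
      \<le> (if \<phi> x = \<phi> y then (?n x + ?n y) / 2 else 0)" by simp
  qed
  also have "\<dots> = ((\<Sum>x\<in>I. \<Sum>y\<in>I. if \<phi> x = \<phi> y then ?n x else 0) +
      (\<Sum>x\<in>I. \<Sum>y\<in>I. if \<phi> x = \<phi> y then ?n y else 0)) / 2"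
    unfolding sum.distrib[symmetric] sum_divide_distrib by (intro sum.cong refl) auto
  also have "\<dots> = (\<Sum>x\<in>I. \<Sum>y\<in>I. if \<phi> x = \<phi> y then ?n x else 0)"
    unfolding sym by simp
  also have "\<dots> = (\<Sum>x\<in>I. card {y\<in>I. \<phi> x = \<phi> y} * ?n x)"
    using fin by (intro sum.cong refl) (simp add: sum.If_cases Int_def)
  also have "\<dots> \<le> (\<Sum>x\<in>I. M * ?n x)"
    using fib by (intro sum_mono mult_right_mono) auto
  finally have *: "Re (\<Sum>x\<in>I. \<Sum>y\<in>I. if \<phi> x = \<phi> y then \<alpha> x * cnj (\<alpha> y) else 0) \<le> M * (\<Sum>x\<in>I. ?n x)"
    by (simp add: sum_distrib_left)
  from has_integral_Re[OF integral_trig_sum_squared[OF fin, of \<alpha> \<phi> x0]]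
  have "integral {x0..x0 + 2 * pi} (\<lambda>t. (cmod (\<Sum>x\<in>I. \<alpha> x * cis (of_int (\<phi> x) * t)))\<^sup>2) =
     2 * pi * Re (\<Sum>x\<in>I. \<Sum>y\<in>I. if \<phi> x = \<phi> y then \<alpha> x * cnj (\<alpha> y) else 0)"
    by (simp add: integral_unique)
  with * show ?thesis by simp
qed

text \<open>The larger index decides: if \<open>l < j\<close>, then \<open>p j\<close> is at least
  \<open>4 * p l\<close>, which exceeds \<open>p k + p l\<close>. Hence the larger indices agree,
  and then so do the smaller ones.\<close>

lemma lacunary_sums_distinct:
  fixes p :: "nat \<Rightarrow> nat"
  assumes lac: "\<And>j. j \<ge> j0 \<Longrightarrow> 4 * p j \<le> p (Suc j)" and pos: "\<And>j. p j > 0" and mono: "strict_mono p"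
    and "j0 \<le> i" "i \<le> j" "j0 \<le> k" "k \<le> l" "p i + p j = p k + p l"
  shows "i = k \<and> j = l"
proof -
  have le: False if "l' < j'" "j0 \<le> k'" "k' \<le> l'" "p i' + p j' = p k' + p l'" for i' j' k' l'
  proof -
    have "p k' \<le> p l'" using mono that(3) by (simp add: strict_mono_less_eq)
    have "4 * p l' \<le> p (Suc l')" using lac that by simp
    also have "p (Suc l') \<le> p j'" using mono that(1) by (simp add: strict_mono_less_eq Suc_le_eq)
    finally show False using pos[of i'] pos[of l'] \<open>p k' \<le> p l'\<close> that(4) by linarith
  qed
  have "j = l"
    using le[of l j k i] le[of j l i k] assms by (metis linorder_neqE_nat)
  with assms(8) show ?thesis using mono by (simp add: strict_mono_eq)
qed

text \<open>The square of the sum has the frequencies \<open>p i + p j\<close>, each produced by at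
  most two ordered pairs. Such a sum therefore cannot concentrate its square integral on a small
  set, which is how the bound is used later.\<close>

lemma integral_lacunary_power4:
  fixes p :: "nat \<Rightarrow> nat" and d :: "nat \<Rightarrow> complex"
  assumes lac: "\<And>j. j \<ge> j0 \<Longrightarrow> 4 * p j \<le> p (Suc j)" and pos: "\<And>j. p j > 0" and mono: "strict_mono p"
  shows "integral {x0..x0 + 2 * pi} (\<lambda>t. cmod (\<Sum>j\<in>{j0..J}. d j * cis (- (p j * t))) ^ 4)
     \<le> 4 * pi * (\<Sum>j\<in>{j0..J}. (cmod (d j))\<^sup>2)\<^sup>2"
proof -
  let ?I = "{j0..J} \<times> {j0..J}"
  let ?\<phi> = "\<lambda>(i, j). - int (p i + p j)"
  let ?\<alpha> = "\<lambda>(i, j). d i * d j"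
  have fib: "card {y\<in>?I. ?\<phi> x = ?\<phi> y} \<le> 2" if "x \<in> ?I" for x
  proof -
    obtain i j where x: "x = (i, j)" by force
    have "y = (i, j) \<or> y = (j, i)" if y: "y \<in> ?I" "?\<phi> x = ?\<phi> y" for y
    proof -
      obtain k l where kl: "y = (k, l)" by force
      have ge: "j0 \<le> i" "j0 \<le> j" "j0 \<le> k" "j0 \<le> l" and eq: "p i + p j = p k + p l"
        using y \<open>x \<in> ?I\<close> by (auto simp: x kl)
      have D: "i' = k' \<and> j' = l'"
        if "j0 \<le> i'" "i' \<le> j'" "j0 \<le> k'" "k' \<le> l'" "p i' + p j' = p k' + p l'" for i' j' k' l'
        by (rule lacunary_sums_distinct[of j0 p]) (use lac pos mono that in auto)
      show ?thesis
      proof (cases "i \<le> j"; cases "k \<le> l")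
        assume "i \<le> j" "k \<le> l" then show ?thesis using D[of i j k l] ge eq kl by simp
      next
        assume "i \<le> j" "\<not> k \<le> l" then show ?thesis using D[of i j l k] ge eq kl by simp
      next
        assume "\<not> i \<le> j" "k \<le> l" then show ?thesis using D[of j i k l] ge eq kl by simp
      next
        assume "\<not> i \<le> j" "\<not> k \<le> l" then show ?thesis using D[of j i l k] ge eq kl by simp
      qed
    qed
    then have "{y\<in>?I. ?\<phi> x = ?\<phi> y} \<subseteq> {(i, j), (j, i)}" by auto
    then have "card {y\<in>?I. ?\<phi> x = ?\<phi> y} \<le> card {(i, j), (j, i)}"
      by (rule card_mono[OF finite.insertI[OF finite.insertI[OF finite.emptyI]]])
    also have "\<dots> \<le> 2" using card_length[of "[(i, j), (j, i)]"] by simp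
    finally show ?thesis .
  qed
  have sq: "(cmod (\<Sum>x\<in>?I. ?\<alpha> x * cis (of_int (?\<phi> x) * t)))\<^sup>2 = cmod (\<Sum>j\<in>{j0..J}. d j * cis (- (p j * t))) ^ 4" for t :: real
  proof -
    have "(\<Sum>x\<in>?I. ?\<alpha> x * cis (of_int (?\<phi> x) * t)) =
      (\<Sum>i\<in>{j0..J}. \<Sum>j\<in>{j0..J}. (d i * cis (- (p i * t))) * (d j * cis (- (p j * t))))"
      unfolding sum.cartesian_product
      by (intro sum.cong refl) (auto simp: cis_mult algebra_simps)
    also have "\<dots> = (\<Sum>j\<in>{j0..J}. d j * cis (- (p j * t)))\<^sup>2"
      by (simp add: power2_eq_square sum_product)
    finally show ?thesis by (simp add: norm_power flip: power_mult)
  qed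
  have "(\<Sum>x\<in>?I. (cmod (?\<alpha> x))\<^sup>2) = (\<Sum>j\<in>{j0..J}. (cmod (d j))\<^sup>2)\<^sup>2"
    by (simp add: power2_eq_square[of "sum _ _"] sum_product sum.cartesian_product norm_mult
        power_mult_distrib case_prod_beta)
  moreover have "integral {x0..x0 + 2 * pi} (\<lambda>t. cmod (\<Sum>j\<in>{j0..J}. d j * cis (- (p j * t))) ^ 4) \<le>
      2 * pi * (real 2 * (\<Sum>x\<in>?I. (cmod (?\<alpha> x))\<^sup>2))"
    unfolding sq[symmetric] by (rule integral_trig_sum_squared_le[OF _ fib]) auto
  ultimately show ?thesis by simp
qed

subsection \<open>Curves with tents\<close>

locale tent_curve =
  fixes t0 :: real and A :: "real set"
  assumes finite_A: "finite A" and A_subset: "A \<subseteq> {t0..t0 + 2 * pi}"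
    and start_in_A: "t0 \<in> A" and end_in_A: "t0 + 2 * pi \<in> A"
begin

text \<open>\<open>mu\<close> is the distance to \<open>A\<close>; the height \<open>mu t / 8\<close> of the tents keeps \<open>curve t\<close> in a fixed
nontangential sector at the nearest point of \<open>A\<close>. Writing \<open>z = curve t\<close>, \<open>nu t\<close> is \<open>dz / (\<i> z dt)\<close> away from
the kinks, so that its real part is 1.\<close>

definition mu :: "real \<Rightarrow> real" where "mu t = infdist t A"
definition rho :: "real \<Rightarrow> real" where "rho t = 1 - mu t / 8"
definition curve :: "real \<Rightarrow> complex" where "curve t = of_real (rho t) * cis t"
text \<open>A finite set containing every point where \<open>mu\<close> has a corner: the points of
  \<open>A\<close> and the points equidistant from two of them.\<close>

definition kinks :: "real set" where "kinks = A \<union> (\<lambda>(a, b). (a + b) / 2) ` (A \<times> A)"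
text \<open>The slope of the tents. The value 0 at the kinks makes the bound 1 on its modulus hold
  everywhere.\<close>

definition sigma :: "real \<Rightarrow> real" where "sigma t = (if t \<in> kinks then 0 else deriv mu t)"
definition nu :: "real \<Rightarrow> complex" where "nu t = Complex 1 (sigma t / (8 * rho t))"

abbreviation "period \<equiv> {t0..t0 + 2 * pi}"

lemma A_nonempty: "A \<noteq> {}" using start_in_A by auto

lemma nearest: obtains a where "a \<in> A" "mu t = \<bar>t - a\<bar>"
  using infdist_attains_inf[of A t] A_nonempty finite_A
  by (auto simp: mu_def dist_real_def finite_imp_closed)

lemma mu_le: "a \<in> A \<Longrightarrow> mu t \<le> \<bar>t - a\<bar>"
  using infdist_le[of a A t] by (simp add: mu_def dist_real_def)

lemma mu_nonneg: "0 \<le> mu t"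
  by (simp add: mu_def infdist_nonneg)

lemma mu_Lipschitz: "mu s \<le> mu t + \<bar>s - t\<bar>"
  using infdist_triangle[of s A t] by (simp add: mu_def dist_real_def)

lemma mu_le_start: "t \<in> period \<Longrightarrow> mu t \<le> t - t0"
  using mu_le[OF start_in_A, of t] by auto

lemma mu_le_end: "t \<in> period \<Longrightarrow> mu t \<le> t0 + 2 * pi - t"
  using mu_le[OF end_in_A, of t] by auto

lemma mu_le_pi: "t \<in> period \<Longrightarrow> mu t \<le> pi"
  using mu_le_start[of t] mu_le_end[of t] by linarith

lemma mu_A: "a \<in> A \<Longrightarrow> mu a = 0"
  by (simp add: mu_def)

lemma continuous_mu [continuous_intros]: "continuous_on S f \<Longrightarrow> continuous_on S (\<lambda>x. mu (f x))"
  unfolding mu_def by (intro continuous_on_infdist)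

lemma continuous_rho [continuous_intros]: "continuous_on S rho"
  unfolding rho_def by (intro continuous_intros) auto

lemma continuous_curve [continuous_intros]: "continuous_on S curve"
  unfolding curve_def by (intro continuous_intros)

lemma rho_bounds: assumes "t \<in> period" shows "1 / 2 \<le> rho t" "rho t \<le> 1"
  using mu_le_pi[OF assms] mu_nonneg[of t] pi_less_4 by (auto simp: rho_def)

lemma norm_curve: "t \<in> period \<Longrightarrow> cmod (curve t) = rho t"
  using rho_bounds[of t] by (simp add: curve_def norm_mult)

lemma norm_curve_le: "t \<in> period \<Longrightarrow> cmod (curve t) \<le> 1"
  using rho_bounds[of t] by (simp add: norm_curve)

lemma finite_kinks: "finite kinks"
  using finite_A by (auto simp: kinks_def)

text \<open>Off the kinks the nearest point \<open>a\<close> of \<open>A\<close> is unique. As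
  \<open>A\<close> is finite, \<open>a\<close> stays nearest in a neighbourhood, where
  \<open>mu\<close> is an affine function of slope \<open>sgn (t - a)\<close>.\<close>

lemma mu_deriv:
  assumes "t \<notin> kinks"
  shows "(mu has_real_derivative sigma t) (at t)" and "\<bar>sigma t\<bar> \<le> 1"
proof -
  obtain a where a: "a \<in> A" "mu t = \<bar>t - a\<bar>" by (rule nearest)
  have "t \<noteq> a" using assms a by (auto simp: kinks_def)
  have lt: "\<bar>t - a\<bar> < \<bar>t - b\<bar>" if "b \<in> A" "b \<noteq> a" for b
  proof -
    have "\<bar>t - a\<bar> \<le> \<bar>t - b\<bar>" using mu_le[OF that(1), of t] a by simp
    moreover have "\<bar>t - a\<bar> \<noteq> \<bar>t - b\<bar>"
    proof
      assume "\<bar>t - a\<bar> = \<bar>t - b\<bar>"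
      then have "t = (\<lambda>(a, b). (a + b) / 2) (a, b)" using that(2) by (auto simp: abs_if split: if_splits)
      then show False using assms a(1) that(1) unfolding kinks_def by blast
    qed
    ultimately show ?thesis by simp
  qed
  have "eventually (\<lambda>s. \<forall>b\<in>A. \<bar>s - a\<bar> \<le> \<bar>s - b\<bar>) (nhds t)"
    unfolding eventually_ball_finite_distrib[OF finite_A]
  proof
    fix b assume b: "b \<in> A"
    show "eventually (\<lambda>s. \<bar>s - a\<bar> \<le> \<bar>s - b\<bar>) (nhds t)"
    proof (cases "b = a")
      case False
      have "((\<lambda>s. \<bar>s - b\<bar> - \<bar>s - a\<bar>) \<longlongrightarrow> \<bar>t - b\<bar> - \<bar>t - a\<bar>) (nhds t)"
        by (intro tendsto_intros filterlim_ident)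
      from order_tendstoD(1)[OF this, of 0] lt[OF b False]
      show ?thesis by (auto elim: eventually_mono)
    qed simp
  qed
  then have ev: "eventually (\<lambda>s. mu s = \<bar>s - a\<bar>) (nhds t)"
  proof eventually_elim
    case (elim s)
    obtain b where "b \<in> A" "mu s = \<bar>s - b\<bar>" by (rule nearest)
    then show ?case using elim mu_le[OF a(1), of s] by force
  qed
  have "((\<lambda>s. sgn (t - a) * (s - a)) \<longlongrightarrow> sgn (t - a) * (t - a)) (nhds t)"
    by (intro tendsto_intros filterlim_ident)
  moreover have "sgn (t - a) * (t - a) > 0" using \<open>t \<noteq> a\<close> by (auto simp: sgn_if)
  ultimately have "eventually (\<lambda>s. sgn (t - a) * (s - a) > 0) (nhds t)" by (rule order_tendstoD)
  with ev have ev': "eventually (\<lambda>s. mu s = sgn (t - a) * (s - a)) (nhds t)"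
    by eventually_elim (auto simp: sgn_if split: if_splits)
  have "((\<lambda>s. sgn (t - a) * (s - a)) has_real_derivative sgn (t - a)) (at t)"
    by (auto intro!: derivative_eq_intros)
  then have D: "(mu has_real_derivative sgn (t - a)) (at t)"
    using DERIV_cong_ev[OF refl ev' refl] by blast
  then have "sigma t = sgn (t - a)" using assms by (simp add: sigma_def DERIV_imp_deriv)
  with D show "(mu has_real_derivative sigma t) (at t)" "\<bar>sigma t\<bar> \<le> 1"
    by (auto simp: sgn_if)
qed

lemma sigma_le: "\<bar>sigma t\<bar> \<le> 1"
  using mu_deriv(2)[of t] by (cases "t \<in> kinks") (auto simp: sigma_def)

lemma Re_nu [simp]: "Re (nu t) = 1" by (simp add: nu_def)

lemma norm_nu: assumes "t \<in> period" shows "cmod (nu t) \<le> 5 / 4"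
proof -
  have "\<bar>sigma t / (8 * rho t)\<bar> \<le> 1 / 4"
    using rho_bounds[OF assms] sigma_le[of t] by (simp add: abs_mult divide_simps)
  moreover have "cmod (nu t) \<le> \<bar>Re (nu t)\<bar> + \<bar>Im (nu t)\<bar>" by (rule cmod_le)
  ultimately show ?thesis by (simp add: nu_def)
qed

section \<open>Line integrals along the curve\<close>

lemma curve_deriv:
  assumes "t \<in> period" "t \<notin> kinks"
  shows "(curve has_vector_derivative (\<i> * curve t * nu t)) (at t)"
proof -
  have "(rho has_real_derivative - sigma t / 8) (at t)"
    unfolding rho_def by (auto intro!: derivative_eq_intros mu_deriv assms)
  then have 1: "((\<lambda>t. complex_of_real (rho t)) has_vector_derivative of_real (- sigma t / 8)) (at t)"
    using has_vector_derivative_of_real has_real_derivative_iff_has_vector_derivative by blast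
  have 2: "(cis has_vector_derivative (\<i> * cis t)) (at t)"
    using cis_has_vector_derivative[of 1 t UNIV] by simp
  have "rho t \<noteq> 0" using rho_bounds[OF assms(1)] by auto
  then have "nu t = 1 + \<i> * of_real (sigma t) / (8 * of_real (rho t))"
    by (auto simp: nu_def complex_eq_iff)
  then have "of_real (rho t) * (\<i> * cis t) + of_real (- sigma t / 8) * cis t = \<i> * curve t * nu t"
    using \<open>rho t \<noteq> 0\<close> by (simp add: curve_def field_simps)
  with has_vector_derivative_mult[OF 1 2] show ?thesis
    unfolding curve_def by simp
qed

lemma closed_curve: "curve (t0 + 2 * pi) = curve t0"
proof -
  have "cis (t0 + 2 * pi) = cis t0" by (simp add: cis_mult[symmetric])
  then show ?thesis by (simp add: curve_def rho_def mu_A start_in_A end_in_A)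
qed

text \<open>Cauchy's theorem: up to the factor \<open>\<i>\<close> the integrand is the derivative
  along the curve of a primitive of \<Phi> on the disc, the curve is closed, and finitely many kinks
  do no harm to the fundamental theorem of calculus.\<close>

lemma has_integral_curve_0:
  assumes "\<Phi> holomorphic_on ball 0 r" "r > 1"
  shows "((\<lambda>t. curve t * \<Phi> (curve t) * nu t) has_integral 0) period"
proof -
  obtain \<Psi> where \<Psi>: "\<And>z. z \<in> ball 0 r \<Longrightarrow> (\<Psi> has_field_derivative \<Phi> z) (at z)"
    using holomorphic_convex_primitive'[OF convex_ball open_ball assms(1)]
    by (metis at_within_open open_ball)
  have in_ball: "curve t \<in> ball 0 r" if "t \<in> period" for t
    using norm_curve_le[OF that] assms(2) by simp
  have "((\<lambda>t. \<i> * curve t * nu t * \<Phi> (curve t)) has_integral ((\<Psi> \<circ> curve) (t0 + 2 * pi) - (\<Psi> \<circ> curve) t0)) period"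
  proof (rule fundamental_theorem_of_calculus_interior_strong[OF finite_kinks])
    fix t assume t: "t \<in> {t0<..<t0 + 2 * pi} - kinks"
    then show "(\<Psi> \<circ> curve has_vector_derivative \<i> * curve t * nu t * \<Phi> (curve t)) (at t)"
      by (intro field_vector_diff_chain_at curve_deriv \<Psi> in_ball) auto
  next
    have "continuous_on (ball 0 r) \<Psi>"
      by (meson \<Psi> DERIV_isCont continuous_at_imp_continuous_on)
    then show "continuous_on period (\<Psi> \<circ> curve)"
      by (intro continuous_on_compose continuous_intros) (rule continuous_on_subset, use in_ball in auto)
  qed simp
  then have "((\<lambda>t. - \<i> * (\<i> * curve t * nu t * \<Phi> (curve t))) has_integral - \<i> * 0) period"
    by (intro has_integral_mult_right) (simp add: closed_curve)
  then show ?thesis by (simp add: mult_ac)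
qed

text \<open>The winding number about 0 is one. The primitive \<open>G\<close> is
  \<open>-\<i>\<close> times a continuous logarithm of the curve; its imaginary part returns to its
  initial value and its real part grows by \<open>2 * pi\<close>.\<close>

lemma has_integral_nu: "(nu has_integral 2 * pi) period"
proof -
  define G where "G = (\<lambda>t. complex_of_real t - \<i> * of_real (ln (rho t)))"
  have "(nu has_integral (G (t0 + 2 * pi) - G t0)) period"
  proof (rule fundamental_theorem_of_calculus_interior_strong[OF finite_kinks])
    fix t assume t: "t \<in> {t0<..<t0 + 2 * pi} - kinks"
    have pos: "rho t > 0" using rho_bounds[of t] t by auto
    have "((\<lambda>t. ln (rho t)) has_real_derivative (- sigma t / 8) / rho t) (at t)"
      using pos t unfolding rho_def by (auto intro!: derivative_eq_intros mu_deriv)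
    then have 1: "((\<lambda>t. complex_of_real (ln (rho t))) has_vector_derivative of_real ((- sigma t / 8) / rho t)) (at t)"
      using has_vector_derivative_of_real has_real_derivative_iff_has_vector_derivative by blast
    have 2: "((\<lambda>t. complex_of_real t) has_vector_derivative of_real 1) (at t)"
      by (intro has_vector_derivative_of_real) (auto intro!: derivative_eq_intros simp flip: has_real_derivative_iff_has_vector_derivative)
    have "nu t = of_real 1 - \<i> * of_real ((- sigma t / 8) / rho t)"
      by (auto simp: nu_def complex_eq_iff)
    then show "(G has_vector_derivative nu t) (at t)" unfolding G_def
      using has_vector_derivative_diff[OF 2 has_vector_derivative_mult_right[OF 1, of "\<i>"]] by (simp only:)
  next
    have "rho t \<noteq> 0" if "t \<in> period" for t using rho_bounds[OF that] by auto
    then show "continuous_on period G"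
      unfolding G_def by (intro continuous_intros) auto
  qed simp
  then show ?thesis
    by (simp add: G_def rho_def mu_A start_in_A end_in_A)
qed

text \<open>Cauchy's formula at 0: write \<open>W z = W 0 + z * V z\<close>, with \<open>V\<close>
  analytic by removal of the singularity. The second summand integrates to 0.\<close>

lemma has_integral_curve:
  fixes W :: "complex \<Rightarrow> complex"
  assumes "W holomorphic_on ball 0 r" "r > 1"
  shows "((\<lambda>t. W (curve t) * nu t) has_integral 2 * pi * W 0) period"
proof -
  define V where "V = (\<lambda>z::complex. if z = 0 then deriv W 0 else (W z - W 0) / (z - 0))"
  have "V holomorphic_on ball 0 r"
    unfolding V_def using assms by (intro pole_lemma) auto
  from has_integral_add[OF has_integral_curve_0[OF this assms(2)] has_integral_mult_right[OF has_integral_nu, of "W 0"]]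
  have "((\<lambda>t. curve t * V (curve t) * nu t + W 0 * nu t) has_integral 2 * pi * W 0) period"
    by (simp add: mult_ac)
  moreover have "curve t * V (curve t) * nu t + W 0 * nu t = W (curve t) * nu t" for t
  proof -
    have "curve t * V (curve t) = W (curve t) - W 0" by (simp add: V_def)
    then have "W (curve t) = curve t * V (curve t) + W 0" by simp
    then show ?thesis by (simp only: distrib_right)
  qed
  ultimately show ?thesis by simp
qed

text \<open>With \<open>R = cnj (z * Q z)\<close>: since \<open>P * cnj R\<close> is analytic and vanishes at 0, \<open>P + R\<close> and \<open>R\<close>
have the same integral against \<open>cnj R * nu\<close>, and \<open>Re nu = 1\<close>.\<close>

lemma integral_coanalytic_le:
  assumes P: "P holomorphic_on ball 0 r" and Q: "Q holomorphic_on ball 0 r" and "r > 1"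
    and bound: "\<And>t. t \<in> period \<Longrightarrow> cmod (P (curve t) + cnj (curve t * Q (curve t))) \<le> M"
  shows "integral period (\<lambda>t. (cmod (curve t * Q (curve t)))\<^sup>2) \<le> 10 * M\<^sup>2"
proof -
  let ?R = "\<lambda>t. curve t * Q (curve t)"
  have "curve ` period \<subseteq> ball 0 r" using norm_curve_le \<open>r > 1\<close> by force
  then have cQ: "continuous_on period (\<lambda>t. Q (curve t))"
    by (intro continuous_on_compose2[OF holomorphic_on_imp_continuous_on[OF Q]] continuous_intros) auto
  have int: "(\<lambda>t. (cmod (?R t))\<^sup>2) integrable_on period"
    by (intro integrable_continuous_real continuous_intros cQ)
  have "((\<lambda>t. curve t * (P (curve t) * Q (curve t)) * nu t) has_integral 0) period"
    by (intro has_integral_curve_0[of "\<lambda>z. P z * Q z", OF _ \<open>r > 1\<close>] holomorphic_intros P Q)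
  from has_integral_Re[OF this]
  have 0: "((\<lambda>t. Re (P (curve t) * ?R t * nu t)) has_integral 0) period"
    by (simp add: mult_ac)
  \<comment> \<open>\<open>?R\<close> is the conjugate of the coanalytic part. Since
    \<open>Re nu = 1\<close>, replacing \<open>P\<close> by \<open>?u\<close> costs exactly the
    square of \<open>cmod (?R t)\<close>; the remaining product is split so that half of this square
    is left over.\<close>
  have le: "Re (P (curve t) * ?R t * nu t) \<le> 25 / 32 * M\<^sup>2 - 1 / 2 * (cmod (?R t))\<^sup>2" if t: "t \<in> period" for t
  proof -
    let ?u = "P (curve t) + cnj (?R t)"
    have "P (curve t) * ?R t * nu t = ?u * ?R t * nu t - of_real ((cmod (?R t))\<^sup>2) * nu t"
      unfolding complex_norm_square by (simp add: algebra_simps del: complex_cnj_mult)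
    then have "Re (P (curve t) * ?R t * nu t) = Re (?u * ?R t * nu t) - (cmod (?R t))\<^sup>2"
      by (simp del: complex_cnj_mult of_real_power add: Re_complex_of_real)
    also have "Re (?u * ?R t * nu t) \<le> cmod (?u * ?R t * nu t)" by (rule complex_Re_le_cmod)
    also have "\<dots> = cmod ?u * cmod (?R t) * cmod (nu t)" by (simp only: norm_mult)
    also have "\<dots> \<le> M * cmod (?R t) * (5 / 4)"
      using bound[OF t] norm_nu[OF t] order_trans[OF norm_ge_zero bound[OF t]] by (intro mult_mono) auto
    finally show ?thesis
      using zero_le_power2[of "5 / 4 * M - cmod (?R t)"] by (simp add: power2_eq_square algebra_simps)
  qed
  have "0 \<le> integral period (\<lambda>t. 25 / 32 * M\<^sup>2 - 1 / 2 * (cmod (?R t))\<^sup>2)"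
    using int by (intro has_integral_le[OF 0 integrable_integral] le integrable_diff integrable_on_cmult_left) auto
  also have "\<dots> = 25 / 32 * M\<^sup>2 * (2 * pi) - 1 / 2 * integral period (\<lambda>t. (cmod (?R t))\<^sup>2)"
    using int by (subst integral_diff) (auto intro!: integrable_on_cmult_left)
  finally have "integral period (\<lambda>t. (cmod (?R t))\<^sup>2) \<le> 25 / 8 * pi * M\<^sup>2" by simp
  also have "\<dots> \<le> 10 * M\<^sup>2"
    using pi_less_4 pi_approx(2) by (intro mult_right_mono) auto
  finally show ?thesis .
qed

text \<open>A continuous substitute for the indicator of the gaps, rising from 0 to 1 while the
  distance to \<open>A\<close> goes from \<open>g\<close> to \<open>2 * g\<close>.\<close>

definition cutoff :: "real \<Rightarrow> real \<Rightarrow> real" where "cutoff g t = max 0 (min 1 (mu t / g - 1))"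

lemma continuous_cutoff: "g > 0 \<Longrightarrow> continuous_on S (cutoff g)"
  unfolding cutoff_def by (intro continuous_intros) auto

lemma cutoff_bounds: "0 \<le> cutoff g t" "cutoff g t \<le> 1"
  by (auto simp: cutoff_def)

lemma cutoff_eq_1: "g > 0 \<Longrightarrow> 2 * g \<le> mu t \<Longrightarrow> cutoff g t = 1"
  by (simp add: cutoff_def le_divide_eq)

lemma cutoff_eq_0: "g > 0 \<Longrightarrow> mu t \<le> g \<Longrightarrow> cutoff g t = 0"
  by (simp add: cutoff_def divide_le_eq)

text \<open>A smoothed Herglotz integral of the indicator of the gaps, with its poles pushed out to radius \<open>1 + g\<close>:
its real part is nonnegative on the disc, bounded below over large gaps, and small at 0.\<close>

definition herglotz :: "real \<Rightarrow> complex \<Rightarrow> complex" where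
  "herglotz g z = integral period (\<lambda>s. of_real (cutoff g s) / (1 + of_real g - z * cis (- s)))"

section \<open>Bounds for the Herglotz integral and the damping function\<close>

lemma Re_herglotz_denominator: "1 - cmod z \<le> Re (1 - z * cis (- s))"
  using complex_Re_le_cmod[of "z * cis (- s)"] by (simp add: norm_mult)

lemma herglotz_denominator_nonzero:
  assumes "cmod z < 1 + g" shows "1 + of_real g - z * cis (- s) \<noteq> 0"
proof
  assume "1 + of_real g - z * cis (- s) = 0"
  then have "Re (1 - z * cis (- s)) = - g" by (simp add: complex_eq_iff)
  then show False using Re_herglotz_denominator[of z s] assms by simp
qed

lemma continuous_herglotz_integrand:
  assumes "g > 0" "cmod z < 1 + g"
  shows "continuous_on S (\<lambda>s. of_real (cutoff g s) / (1 + of_real g - z * cis (- s)))"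
  using assms herglotz_denominator_nonzero
  by (intro continuous_intros continuous_cutoff) auto

lemma holomorphic_herglotz:
  assumes "g > 0" shows "herglotz g holomorphic_on ball 0 (1 + g)"
proof -
  let ?f = "\<lambda>z s. complex_of_real (cutoff g s) / (1 + of_real g - z * cis (- s))"
  let ?f' = "\<lambda>z s. complex_of_real (cutoff g s) * cis (- s) / (1 + of_real g - z * cis (- s))\<^sup>2"
  have nz: "1 + of_real g - z * cis (- s) \<noteq> 0" if "z \<in> ball 0 (1 + g)" for z s
    using that by (intro herglotz_denominator_nonzero) auto
  have "(\<lambda>z. integral (cbox t0 (t0 + 2 * pi)) (?f z)) holomorphic_on ball 0 (1 + g)"
  proof (rule leibniz_rule_holomorphic)
    fix z :: complex and s assume "z \<in> ball 0 (1 + g)"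
    with nz[OF this, of s] show "((\<lambda>z. ?f z s) has_field_derivative ?f' z s) (at z within ball 0 (1 + g))"
      by (auto intro!: derivative_eq_intros simp: power2_eq_square)
  next
    fix z :: complex assume "z \<in> ball 0 (1 + g)"
    then show "?f z integrable_on cbox t0 (t0 + 2 * pi)"
      using assms by (intro integrable_continuous continuous_herglotz_integrand) auto
  next
    show "continuous_on (ball 0 (1 + g) \<times> cbox t0 (t0 + 2 * pi)) (\<lambda>(z, s). ?f' z s)"
      unfolding case_prod_beta using assms nz
      by (intro continuous_intros continuous_on_compose2[OF continuous_cutoff[OF assms]]) auto
  qed auto
  then show ?thesis by (simp add: herglotz_def[abs_def])
qed

lemma Re_herglotz:
  assumes "g > 0" "cmod z < 1 + g"
  shows "Re (herglotz g z) = integral period (\<lambda>s. cutoff g s * Re (1 / (1 + of_real g - z * cis (- s))))"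
proof -
  have "((\<lambda>s. of_real (cutoff g s) / (1 + of_real g - z * cis (- s))) has_integral herglotz g z) period"
    unfolding herglotz_def using continuous_herglotz_integrand[OF assms]
    by (intro integrable_integral integrable_continuous_real)
  from integral_unique[OF has_integral_Re[OF this]] show ?thesis
    by (simp add: Re_divide_of_real divide_inverse)
qed

lemma Re_herglotz_kernel_nonneg:
  assumes "g > 0" "cmod z \<le> 1" shows "0 \<le> Re (1 / (1 + of_real g - z * cis (- s)))"
proof -
  have "0 \<le> Re (1 + of_real g - z * cis (- s))"
    using Re_herglotz_denominator[of z s] assms by simp
  then show ?thesis by (simp add: Re_divide)
qed

lemma Re_herglotz_nonneg:
  assumes "g > 0" "cmod z \<le> 1" shows "0 \<le> Re (herglotz g z)"
proof -
  have "cmod z < 1 + g" using assms by simp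
  then show ?thesis using assms
    by (subst Re_herglotz)
       (auto intro!: integral_nonneg integrable_continuous_real continuous_intros continuous_cutoff
         mult_nonneg_nonneg cutoff_bounds Re_herglotz_kernel_nonneg herglotz_denominator_nonzero)
qed

text \<open>On the interval of length \<open>mu t\<close> centred at \<open>t\<close> the cutoff is
  1. There the kernel is at least \<open>8 / (49 * mu t)\<close>, so the length of the interval
  cancels and the bound does not depend on the size of the gap.\<close>

lemma Re_herglotz_curve_ge:
  assumes g: "g > 0" and t: "t \<in> period" and far: "4 * g \<le> mu t"
  shows "8 / 49 \<le> Re (herglotz g (curve t))"
proof -
  let ?K = "\<lambda>s. Re (1 / (1 + of_real g - curve t * cis (- s)))"
  have le1: "cmod (curve t) \<le> 1" by (rule norm_curve_le[OF t])
  then have lt: "cmod (curve t) < 1 + g" using g by simp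
  have cont: "continuous_on S (\<lambda>s. cutoff g s * ?K s)" for S
    using g lt herglotz_denominator_nonzero by (intro continuous_intros continuous_cutoff) auto
  define I where "I = {t - mu t / 2..t + mu t / 2}"
  have I: "I \<subseteq> period"
    using mu_le_start[OF t] mu_le_end[OF t] mu_nonneg[of t] by (auto simp: I_def)
  have mu_pos: "mu t > 0" using g far by linarith
  have in_I: "\<bar>t - s\<bar> \<le> mu t / 2" if "s \<in> I" for s
    using that unfolding I_def atLeastAtMost_iff abs_le_iff by linarith
  have lower: "8 / (49 * mu t) \<le> cutoff g s * ?K s" if s: "s \<in> I" for s
  proof -
    have dist: "\<bar>t - s\<bar> \<le> mu t / 2" by (rule in_I[OF s])
    then have "mu s \<ge> 2 * g" using mu_Lipschitz[of t s] far by linarith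
    then have "cutoff g s = 1" by (rule cutoff_eq_1[OF g])
    define v where "v = 1 + of_real g - curve t * cis (- s)"
    have "mu t / 8 \<le> Re v"
      using Re_herglotz_denominator[of "curve t" s] norm_curve[OF t] g by (simp add: v_def rho_def)
    \<comment> \<open>The radial distance is \<open>mu t / 8\<close>, the angular one at most
      \<open>mu t / 2\<close>, and \<open>g\<close> adds at most \<open>mu t / 4\<close>; together
      this is \<open>7 / 8 * mu t\<close>.\<close>
    have "cmod (1 - curve t * cis (- s)) \<le> cmod (cis (t - s) - curve t * cis (- s)) + cmod (1 - cis (t - s))"
      by (metis add.commute diff_add_cancel add_diff_eq norm_triangle_ineq)
    also have "cis (t - s) - curve t * cis (- s) = of_real (mu t / 8) * cis (t - s)"
      by (simp add: curve_def rho_def cis_mult algebra_simps)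
    also have "cmod (of_real (mu t / 8) * cis (t - s)) = mu t / 8"
      using mu_nonneg by (simp add: norm_mult)
    also have "cmod (1 - cis (t - s)) \<le> \<bar>t - s\<bar>"
      using cmod_cis_minus_1_le[of "t - s"] by (simp add: norm_minus_commute)
    finally have "cmod (1 - curve t * cis (- s)) \<le> 5 / 8 * mu t" using dist by simp
    moreover have "cmod v \<le> g + cmod (1 - curve t * cis (- s))"
      using norm_triangle_ineq[of "of_real g" "1 - curve t * cis (- s)"] g by (simp add: v_def algebra_simps)
    ultimately have "cmod v \<le> 7 / 8 * mu t" using far by linarith
    then have v2: "(cmod v)\<^sup>2 \<le> 49 / 64 * (mu t)\<^sup>2"
      using power_mono[of "cmod v" "7 / 8 * mu t" 2] by (simp add: power_mult_distrib power_divide)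
    have "cmod v > 0" using \<open>mu t / 8 \<le> Re v\<close> mu_pos complex_Re_le_cmod[of v] by linarith
    have "8 / (49 * mu t) = (mu t / 8) / (49 / 64 * (mu t)\<^sup>2)"
      using mu_pos by (simp add: field_simps power2_eq_square)
    also have "\<dots> \<le> Re v / (cmod v)\<^sup>2"
      using v2 \<open>mu t / 8 \<le> Re v\<close> \<open>cmod v > 0\<close> mu_pos by (intro frac_le) auto
    also have "\<dots> = Re (1 / v)" by (simp add: Re_divide cmod_power2)
    finally show ?thesis using \<open>cutoff g s = 1\<close> by (simp add: v_def)
  qed
  have "8 / 49 = integral I (\<lambda>s. 8 / (49 * mu t))"
    using mu_pos by (simp add: I_def)
  also have "\<dots> \<le> integral I (\<lambda>s. cutoff g s * ?K s)"
    by (intro integral_le lower) (auto simp: I_def intro!: integrable_continuous_real cont)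
  also have "\<dots> \<le> integral period (\<lambda>s. cutoff g s * ?K s)"
    using I Re_herglotz_kernel_nonneg[OF g le1]
    by (intro integral_subset_le) (auto simp: I_def intro!: integrable_continuous_real cont mult_nonneg_nonneg cutoff_bounds)
  also have "\<dots> = Re (herglotz g (curve t))"
    by (rule Re_herglotz[OF g lt, symmetric])
  finally show ?thesis .
qed

lemma Re_herglotz_0_le:
  assumes "g > 0" shows "Re (herglotz g 0) \<le> integral period (cutoff g)"
proof -
  have "Re (herglotz g 0) = integral period (\<lambda>s. cutoff g s * (1 / (1 + g)))"
    using assms by (subst Re_herglotz) (auto simp flip: of_real_add simp: Re_divide_of_real)
  also have "\<dots> \<le> integral period (cutoff g)"
  proof (rule integral_le)
    show "cutoff g s * (1 / (1 + g)) \<le> cutoff g s" for s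
      using assms cutoff_bounds[of g s] mult_left_le[of "1 / (1 + g)" "cutoff g s"] by simp
  qed (use assms in \<open>auto intro!: integrable_continuous_real continuous_intros continuous_cutoff\<close>)
  finally show ?thesis .
qed

text \<open>\<open>W = exp (- L * herglotz g)\<close>, so lower bounds on the real part become
  decay. When the integral of the cutoff is at most 2/25, the decay over the gaps beats the square
  of the lower bound at 0, because \<open>8 / 49 > 2 * (2 / 25)\<close>.\<close>

lemma damping_function:
  assumes g: "g > 0" and L: "L \<ge> 0"
  obtains W where "W holomorphic_on ball 0 (1 + g)" "\<And>z. cmod z \<le> 1 \<Longrightarrow> cmod (W z) \<le> 1"
    "\<And>t. t \<in> period \<Longrightarrow> 4 * g \<le> mu t \<Longrightarrow> cmod (W (curve t)) \<le> exp (- (8 / 49 * L))"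
    "exp (- (L * integral period (cutoff g))) \<le> cmod (W 0)"
proof
  let ?W = "\<lambda>z. exp (- (of_real L * herglotz g z))"
  show "?W holomorphic_on ball 0 (1 + g)"
    by (intro holomorphic_intros holomorphic_herglotz g)
  show "cmod (?W z) \<le> 1" if "cmod z \<le> 1" for z
    using Re_herglotz_nonneg[OF g that] L by simp
  show "cmod (?W (curve t)) \<le> exp (- (8 / 49 * L))" if "t \<in> period" "4 * g \<le> mu t" for t
    using mult_left_mono[OF Re_herglotz_curve_ge[OF g that] L] by simp
  show "exp (- (L * integral period (cutoff g))) \<le> cmod (?W 0)"
    using mult_left_mono[OF Re_herglotz_0_le[OF g] L] by simp
qed

end

subsection \<open>Abel summation and simultaneous shifts\<close>

text \<open>Symmetric partial sums, with \<open>a\<close> for the nonnegative and \<open>b\<close>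
  for the negative frequencies. The index 0 contributes \<open>a 0 + b 0\<close>, so applications
  keep \<open>b 0 = 0\<close>.\<close>

definition trig_sum :: "(nat \<Rightarrow> complex) \<Rightarrow> (nat \<Rightarrow> complex) \<Rightarrow> nat \<Rightarrow> real \<Rightarrow> complex" where
  "trig_sum a b n x = (\<Sum>k\<le>n. a k * cis (k * x) + b k * cis (- (k * x)))"

lemma summation_by_parts:
  fixes w :: complex
  shows "(\<Sum>k\<le>N. T k * w ^ k) = (\<Sum>k<N. (\<Sum>l\<le>k. T l) * (w ^ k - w ^ Suc k)) + (\<Sum>l\<le>N. T l) * w ^ N"
  by (induction N) (simp_all add: algebra_simps)

text \<open>Write \<open>z = cis x * w\<close>. If \<open>cnj w ^ k\<close> is replaced by
  \<open>w ^ k\<close> in the negative frequencies, the sum becomes a power series in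
  \<open>w\<close> whose coefficients are the terms of the partial sums at \<open>x\<close>, and
  summation by parts gives \<open>10 * K\<close>. The last sum pays for the replacement.\<close>

lemma abel_nontangential_bound:
  assumes partial: "\<And>n. n \<le> N \<Longrightarrow> cmod (trig_sum a b n x) \<le> K"
    and \<rho>: "0 < \<rho>" "\<rho> \<le> 1" and near: "\<bar>t - x\<bar> \<le> 8 * (1 - \<rho>)" and z: "z = of_real \<rho> * cis t"
  shows "cmod ((\<Sum>k\<le>N. a k * z ^ k) + (\<Sum>k\<le>N. b k * cnj z ^ k)) \<le>
    10 * K + 16 * (\<Sum>k\<le>N. cmod (b k) * (k * \<rho> ^ k * (1 - \<rho>)))"
proof -
  define w where "w = of_real \<rho> * cis (t - x)"
  have norm_w: "cmod w = \<rho>" using \<rho> by (simp add: w_def norm_mult)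
  have K0: "0 \<le> K" using order_trans[OF norm_ge_zero partial[of 0]] by simp
  have zk: "z ^ k = cis (k * x) * w ^ k" and czk: "cnj z ^ k = cis (- (k * x)) * cnj w ^ k" for k
  proof -
    have "cis t ^ k = cis (k * x) * cis (t - x) ^ k" "cis (- t) ^ k = cis (- (k * x)) * cis (- (t - x)) ^ k"
      by (simp_all only: Complex.DeMoivre cis_mult) (simp_all add: algebra_simps)
    then show "z ^ k = cis (k * x) * w ^ k" "cnj z ^ k = cis (- (k * x)) * cnj w ^ k"
      by (simp_all only: z w_def power_mult_distrib complex_cnj_mult cis_cnj complex_cnj_complex_of_real mult_ac)
  qed
  have split: "(\<Sum>k\<le>N. a k * z ^ k) + (\<Sum>k\<le>N. b k * cnj z ^ k) =
     (\<Sum>k\<le>N. (a k * cis (k * x) + b k * cis (- (k * x))) * w ^ k) +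
     (\<Sum>k\<le>N. b k * cis (- (k * x)) * (cnj w ^ k - w ^ k))"
    unfolding sum.distrib[symmetric] zk czk by (intro sum.cong refl) (simp add: algebra_simps)
  \<comment> \<open>The radial part contributes \<open>1 - \<rho>\<close> and the angular part at
    most \<open>8 * (1 - \<rho>)\<close>.\<close>
  have w1: "cmod (1 - w) \<le> 9 * (1 - \<rho>)"
  proof -
    have "1 - w = of_real (1 - \<rho>) - of_real \<rho> * (cis (t - x) - 1)" by (simp add: w_def algebra_simps)
    then have "cmod (1 - w) \<le> cmod (of_real (1 - \<rho>)) + cmod (of_real \<rho> * (cis (t - x) - 1))"
      by (metis norm_triangle_ineq4)
    also have "\<dots> \<le> (1 - \<rho>) + 1 * \<bar>t - x\<bar>"
      unfolding norm_mult norm_of_real using \<rho> by (intro add_mono mult_mono cmod_cis_minus_1_le) auto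
    finally show ?thesis using near by simp
  qed
  have geom: "(1 - \<rho>) * (\<Sum>k<N. \<rho> ^ k) \<le> 1"
    using \<rho> by (simp add: one_diff_power_eq[symmetric])
  have "cmod (\<Sum>k\<le>N. (a k * cis (k * x) + b k * cis (- (k * x))) * w ^ k) \<le>
      (\<Sum>k<N. cmod (trig_sum a b k x * (w ^ k - w ^ Suc k))) + cmod (trig_sum a b N x * w ^ N)"
    unfolding summation_by_parts trig_sum_def by (intro norm_triangle_le add_right_mono sum_norm_le) auto
  also have "\<dots> \<le> (\<Sum>k<N. K * (9 * (1 - \<rho>) * \<rho> ^ k)) + K * 1"
  proof (intro add_mono sum_mono)
    fix k assume "k \<in> {..<N}"
    have "w ^ k - w ^ Suc k = (1 - w) * w ^ k" by (simp add: algebra_simps)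
    then show "cmod (trig_sum a b k x * (w ^ k - w ^ Suc k)) \<le> K * (9 * (1 - \<rho>) * \<rho> ^ k)"
      unfolding norm_mult using \<open>k \<in> {..<N}\<close> K0 w1 \<rho> partial[of k]
      by (auto simp: norm_mult norm_power norm_w intro!: mult_mono)
  next
    show "cmod (trig_sum a b N x * w ^ N) \<le> K * 1"
      unfolding norm_mult norm_power norm_w using K0 \<rho> partial[of N] by (intro mult_mono power_le_one) auto
  qed
  also have "\<dots> = K * (9 * ((1 - \<rho>) * (\<Sum>k<N. \<rho> ^ k))) + K"
    by (simp only: sum_distrib_left mult_ac mult_1_right mult_1_left)
  also have "\<dots> \<le> K * (9 * 1) + K"
    using geom K0 by (intro add_right_mono mult_left_mono) auto
  finally have 1: "cmod (\<Sum>k\<le>N. (a k * cis (k * x) + b k * cis (- (k * x))) * w ^ k) \<le> 10 * K" by simp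
  have "cmod (\<Sum>k\<le>N. b k * cis (- (k * x)) * (cnj w ^ k - w ^ k)) \<le>
     (\<Sum>k\<le>N. 16 * (cmod (b k) * (k * \<rho> ^ k * (1 - \<rho>))))"
  proof (intro sum_norm_le)
    fix k
    have "cnj w ^ k - w ^ k = of_real (\<rho> ^ k) * (cis (- (k * (t - x))) - cis (k * (t - x)))"
      by (simp only: w_def power_mult_distrib complex_cnj_mult cis_cnj complex_cnj_complex_of_real
          Complex.DeMoivre of_real_power mult_minus_right right_diff_distrib)
    then have "cmod (cnj w ^ k - w ^ k) = \<rho> ^ k * cmod (cis (- (k * (t - x))) - cis (k * (t - x)))"
      using \<rho> by (simp add: norm_mult norm_power)
    also have "\<dots> \<le> \<rho> ^ k * (16 * k * (1 - \<rho>))"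
    proof (intro mult_left_mono)
      have "cmod (cis (- (k * (t - x))) - cis (k * (t - x))) \<le> \<bar>- (k * (t - x)) - k * (t - x)\<bar>"
        by (rule cmod_cis_diff_le)
      also have "\<dots> = 2 * k * \<bar>t - x\<bar>" by (simp add: abs_mult flip: mult_2)
      also have "\<dots> \<le> 2 * k * (8 * (1 - \<rho>))" using near by (intro mult_left_mono) auto
      finally show "cmod (cis (- (k * (t - x))) - cis (k * (t - x))) \<le> 16 * k * (1 - \<rho>)"
        by (simp add: algebra_simps)
    qed (use \<rho> in auto)
    finally show "cmod (b k * cis (- (k * x)) * (cnj w ^ k - w ^ k)) \<le> 16 * (cmod (b k) * (k * \<rho> ^ k * (1 - \<rho>)))"
      using mult_left_mono[of "cmod (cnj w ^ k - w ^ k)" "\<rho> ^ k * (16 * k * (1 - \<rho>))" "cmod (b k)"]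
      unfolding norm_mult norm_cis by (simp add: algebra_simps)
  qed
  with 1 show ?thesis
    unfolding split sum_distrib_left[symmetric] by (intro norm_triangle_le) simp
qed

text \<open>Past \<open>j0\<close> each frequency is at most twice its distance to the preceding
  one, so its term is at most \<open>2 * (\<rho> ^ p J - \<rho> ^ p (Suc J))\<close>, and these
  telescope. Each of the first \<open>j0 + 1\<close> terms is at most 1.\<close>

lemma lacunary_abel_sum_le:
  fixes p :: "nat \<Rightarrow> nat" and \<rho> :: real and j0 :: nat
  assumes lac: "\<And>j. j \<ge> j0 \<Longrightarrow> 4 * p j \<le> p (Suc j)" and \<rho>: "0 < \<rho>" "\<rho> \<le> 1"
  shows "(\<Sum>j\<le>J. p j * \<rho> ^ p j * (1 - \<rho>)) \<le> j0 + 3"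
proof -
  have block: "real (v - u) * \<rho> ^ v * (1 - \<rho>) \<le> \<rho> ^ u - \<rho> ^ v" if "u \<le> v" for u v
  proof -
    have "real (v - u) * \<rho> ^ v = (\<Sum>k=u..<v. \<rho> ^ v)" by simp
    also have "\<dots> \<le> (\<Sum>k=u..<v. \<rho> ^ k)" using \<rho> by (intro sum_mono power_decreasing) auto
    finally have "real (v - u) * \<rho> ^ v * (1 - \<rho>) \<le> (\<Sum>k=u..<v. \<rho> ^ k) * (1 - \<rho>)"
      using \<rho> by (intro mult_right_mono) auto
    also have "\<dots> = (\<Sum>k=u..<v. - (\<rho> ^ Suc k - \<rho> ^ k))"
      unfolding sum_distrib_right by (intro sum.cong refl) (simp add: algebra_simps)
    also have "\<dots> = \<rho> ^ u - \<rho> ^ v"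
      unfolding sum_negf using sum_Suc_diff'[OF that, of "\<lambda>k. \<rho> ^ k"] by simp
    finally show ?thesis .
  qed
  have one: "p j * \<rho> ^ p j * (1 - \<rho>) \<le> 1" for j
    using block[of 0 "p j"] zero_less_power[OF \<rho>(1), of "p j"] by simp
  \<comment> \<open>The claim keeps the telescoped remainder, without which the induction would not
    close.\<close>
  have "(\<Sum>j\<le>J. p j * \<rho> ^ p j * (1 - \<rho>)) \<le> (if J \<le> j0 then J + 1 else j0 + 1 + 2 * (1 - \<rho> ^ p J))"
  proof (induction J)
    case 0 show ?case using one[of 0] by simp
  next
    case (Suc J)
    show ?case
    proof (cases "Suc J \<le> j0")
      case True then show ?thesis using Suc one[of "Suc J"] by simp
    next
      case False
      then have le: "4 * p J \<le> p (Suc J)" using lac by simp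
      have "p (Suc J) * \<rho> ^ p (Suc J) * (1 - \<rho>) \<le> 2 * (real (p (Suc J) - p J) * \<rho> ^ p (Suc J) * (1 - \<rho>))"
        using le \<rho> by (auto simp: mult.assoc[symmetric] intro!: mult_right_mono)
      also have "\<dots> \<le> 2 * (\<rho> ^ p J - \<rho> ^ p (Suc J))"
        using block[of "p J" "p (Suc J)"] le by simp
      finally have "p (Suc J) * \<rho> ^ p (Suc J) * (1 - \<rho>) \<le> 2 * (\<rho> ^ p J - \<rho> ^ p (Suc J))" .
      moreover have "\<rho> ^ p J \<le> 1" using \<rho> by (simp add: power_le_one)
      ultimately show ?thesis using Suc False by (auto split: if_splits)
    qed
  qed
  also have "\<dots> \<le> j0 + 3" using zero_less_power[OF \<rho>(1), of "p J"] by auto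
  finally show ?thesis .
qed

lemma sum_over_range:
  fixes p :: "nat \<Rightarrow> nat" and h :: "nat \<Rightarrow> 'a::comm_monoid_add"
  assumes "strict_mono p" "\<And>k. k \<notin> range p \<Longrightarrow> h k = 0"
  shows "(\<Sum>k\<le>p J. h k) = (\<Sum>j\<le>J. h (p j))"
proof -
  have "(\<Sum>k\<le>p J. h k) = (\<Sum>k\<in>p ` {..J}. h k)"
  proof (rule sum.mono_neutral_right)
    show "\<forall>k\<in>{..p J} - p ` {..J}. h k = 0"
    proof
      fix k assume k: "k \<in> {..p J} - p ` {..J}"
      have "k \<notin> range p"
      proof
        assume "k \<in> range p"
        then obtain j where "k = p j" by blast
        with k show False using assms(1) by (auto simp: strict_mono_less_eq)
      qed
      then show "h k = 0" by (rule assms(2))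
    qed
  qed (use assms(1) in \<open>auto simp: strict_mono_less_eq\<close>)
  also have "\<dots> = (\<Sum>j\<le>J. h (p j))"
    using strict_mono_imp_inj_on[OF assms(1)] by (subst sum.reindex) (auto intro: inj_on_subset)
  finally show ?thesis .
qed

section \<open>Shifts that flip one frequency and nearly fix the others\<close>

lemma cmod_cis_uminus_minus_1: "cmod (cis (- x) - 1) = cmod (cis x - 1)"
  using complex_mod_cnj[of "cis x - 1"] by (simp add: cis_cnj)

text \<open>The error \<open>pi * Y\<close> of one move fits into the room gained in the bound,
  since \<open>X - Y\<close> is at least \<open>(H - 1) * Y\<close> and hence at least
  \<open>H * Y / 2\<close>.\<close>

lemma simultaneous_shift_step:
  fixes H X Y :: real
  assumes "H \<ge> 2" "0 \<le> Y" "H * Y \<le> X"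
  shows "2 * pi / H * (D - X) + pi * Y \<le> 2 * pi / H * (D - Y)"
proof -
  have "pi / H * ((2 + H) * Y) \<le> pi / H * (2 * X)"
    using assms mult_right_mono[of 2 H Y] by (intro mult_left_mono) (auto simp: distrib_right)
  moreover have "pi / H * ((2 + H) * Y) = 2 * pi / H * Y + pi * Y" using assms by (simp add: field_simps)
  ultimately show ?thesis by (simp add: right_diff_distrib)
qed

text \<open>The shift is moved successively to the nearest multiple of \<open>2 * pi / P s\<close>; each move disturbs the
earlier conditions by at most \<open>pi * P r / P s\<close>, and these errors sum geometrically.\<close>

lemma simultaneous_shift:
  fixes P :: "nat \<Rightarrow> real"
  assumes pos: "\<And>s. P s > 0" and H: "H \<ge> 2" and grow: "\<And>s. H * P s \<le> P (Suc s)"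
  shows "\<exists>\<theta>. \<bar>\<theta> - pi / P 0\<bar> \<le> 2 * pi / H * (1 / P 0 - 1 / P s) \<and>
     cmod (cis (P 0 * \<theta>) + 1) \<le> 2 * pi / H * (1 - P 0 / P s) \<and>
     (\<forall>r\<in>{1..s}. cmod (cis (P r * \<theta>) - 1) \<le> 2 * pi / H * (1 - P r / P s))"
proof (induction s)
  case 0
  \<comment> \<open>The shift \<open>pi / P 0\<close> flips the frequency \<open>P 0\<close>
    exactly.\<close>
  show ?case using pos[of 0] by (intro exI[of _ "pi / P 0"]) simp
next
  case (Suc s)
  then obtain \<theta> where \<theta>: "\<bar>\<theta> - pi / P 0\<bar> \<le> 2 * pi / H * (1 / P 0 - 1 / P s)"
     "cmod (cis (P 0 * \<theta>) + 1) \<le> 2 * pi / H * (1 - P 0 / P s)"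
     "\<And>r. r \<in> {1..s} \<Longrightarrow> cmod (cis (P r * \<theta>) - 1) \<le> 2 * pi / H * (1 - P r / P s)" by blast
  let ?q = "P (Suc s)"
  \<comment> \<open>The multiple of \<open>2 * pi / P (Suc s)\<close> nearest to \<theta>: the new
    condition holds exactly, and the move is at most half the spacing.\<close>
  define \<phi> where "\<phi> = 2 * pi * of_int (round (?q * \<theta> / (2 * pi))) / ?q"
  have q: "?q > 0" by (rule pos)
  have "\<bar>of_int (round (?q * \<theta> / (2 * pi))) - ?q * \<theta> / (2 * pi)\<bar> \<le> 1 / 2"
    by (rule of_int_round_abs_le)
  then have "2 * pi / ?q * \<bar>of_int (round (?q * \<theta> / (2 * pi))) - ?q * \<theta> / (2 * pi)\<bar> \<le> 2 * pi / ?q * (1 / 2)"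
    using q by (intro mult_left_mono) auto
  moreover have "\<phi> - \<theta> = 2 * pi / ?q * (of_int (round (?q * \<theta> / (2 * pi))) - ?q * \<theta> / (2 * pi))"
    using q by (simp add: \<phi>_def field_simps)
  ultimately have near: "\<bar>\<phi> - \<theta>\<bar> \<le> pi / ?q"
    using q by (simp add: abs_mult)
  have exact: "cis (?q * \<phi>) = 1"
    using q by (simp add: \<phi>_def cis_multiple_2pi)
  have move: "cmod (cis (P r * \<phi>) - cis (P r * \<theta>)) \<le> pi * (P r / ?q)" for r
  proof -
    have "cmod (cis (P r * \<phi>) - cis (P r * \<theta>)) \<le> P r * \<bar>\<phi> - \<theta>\<bar>"
      using cmod_cis_diff_le[of "P r * \<phi>" "P r * \<theta>"] pos[of r]
      by (simp add: abs_mult right_diff_distrib[symmetric])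
    also have "\<dots> \<le> P r * (pi / ?q)" using near pos[of r] by (intro mult_left_mono) auto
    finally show ?thesis by (simp add: field_simps)
  qed
  have YX: "0 \<le> P r / ?q" "H * (P r / ?q) \<le> P r / P s" for r
    using pos[of r] pos[of s] q grow[of s] by (auto simp: field_simps)
  have "\<bar>\<phi> - pi / P 0\<bar> \<le> 2 * pi / H * (1 / P 0 - 1 / ?q)"
  proof -
    have "\<bar>\<phi> - pi / P 0\<bar> \<le> 2 * pi / H * (1 / P 0 - 1 / P s) + pi * (1 / ?q)"
      using near \<theta>(1) by simp
    also have "\<dots> \<le> 2 * pi / H * (1 / P 0 - 1 / ?q)"
      using pos[of s] q grow[of s] by (intro simultaneous_shift_step H) (auto simp: field_simps)
    finally show ?thesis .
  qed
  moreover have "cmod (cis (P 0 * \<phi>) + 1) \<le> 2 * pi / H * (1 - P 0 / ?q)"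
  proof -
    have "cmod (cis (P 0 * \<phi>) + 1) \<le> cmod (cis (P 0 * \<theta>) + 1) + cmod (cis (P 0 * \<phi>) - cis (P 0 * \<theta>))"
      using norm_triangle_ineq[of "cis (P 0 * \<theta>) + 1" "cis (P 0 * \<phi>) - cis (P 0 * \<theta>)"]
      by (simp add: add.commute)
    also have "\<dots> \<le> 2 * pi / H * (1 - P 0 / P s) + pi * (P 0 / ?q)"
      by (intro add_mono \<theta> move)
    also have "\<dots> \<le> 2 * pi / H * (1 - P 0 / ?q)" by (intro simultaneous_shift_step H YX)
    finally show ?thesis .
  qed
  moreover have "cmod (cis (P r * \<phi>) - 1) \<le> 2 * pi / H * (1 - P r / ?q)" if "r \<in> {1..Suc s}" for r
  proof (cases "r = Suc s")
    case True
    then show ?thesis using exact q by simp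
  next
    case False
    have "cmod (cis (P r * \<phi>) - 1) \<le> cmod (cis (P r * \<theta>) - 1) + cmod (cis (P r * \<phi>) - cis (P r * \<theta>))"
      using norm_triangle_ineq[of "cis (P r * \<theta>) - 1" "cis (P r * \<phi>) - cis (P r * \<theta>)"] by simp
    also have "\<dots> \<le> 2 * pi / H * (1 - P r / P s) + pi * (P r / ?q)"
      using that False by (intro add_mono \<theta> move) auto
    also have "\<dots> \<le> 2 * pi / H * (1 - P r / ?q)" by (intro simultaneous_shift_step H YX)
    finally show ?thesis .
  qed
  ultimately show ?case by blast
qed

text \<open>Up to \<open>j0\<close> the terms are merely counted; beyond it the sum at most quarters
  relative to the next term, and \<open>(j0 + 2) / 4 + 1\<close> is at most
  \<open>j0 + 2\<close>.\<close>

lemma sum_le_growth: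
  fixes p :: "nat \<Rightarrow> nat"
  assumes lac: "\<And>j. j \<ge> j0 \<Longrightarrow> 4 * p j \<le> p (Suc j)" and mono: "strict_mono p"
  shows "(\<Sum>j\<le>n. p j) \<le> (j0 + 2) * p n"
proof (induction n)
  case 0 show ?case by simp
next
  case (Suc n)
  show ?case
  proof (cases "n < j0")
    case True
    have "(\<Sum>j\<le>Suc n. p j) \<le> (\<Sum>j\<le>Suc n. p (Suc n))"
      using mono by (intro sum_mono) (auto simp: strict_mono_less_eq)
    also have "\<dots> \<le> (j0 + 2) * p (Suc n)" using True by simp
    finally show ?thesis .
  next
    case False
    then have "4 * p n \<le> p (Suc n)" using lac by simp
    then have "(j0 + 2) * (4 * p n) \<le> (j0 + 2) * p (Suc n)" by (rule mult_le_mono2)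
    with Suc have "4 * (\<Sum>j\<le>n. p j) \<le> (j0 + 2) * p (Suc n)" by linarith
    moreover have "4 * p (Suc n) \<le> 3 * (j0 + 2) * p (Suc n)"
      by (intro mult_le_mono1) simp
    ultimately show ?thesis by simp
  qed
qed

subsection \<open>The estimate at one stage\<close>

definition analytic_part :: "(nat \<Rightarrow> complex) \<Rightarrow> nat \<Rightarrow> complex \<Rightarrow> complex" where
  "analytic_part a N z = (\<Sum>k\<le>N. a k * z ^ k)"

definition coanalytic_part :: "(nat \<Rightarrow> complex) \<Rightarrow> (nat \<Rightarrow> nat) \<Rightarrow> nat \<Rightarrow> complex \<Rightarrow> complex" where
  "coanalytic_part d p J z = (\<Sum>j\<le>J. d j * cnj z ^ p j)"

text \<open>The coefficients of the increment of a coanalytic part under rotation by \<theta>; the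
  increment is thus again a coanalytic part with the same frequencies.\<close>

definition shift_coeff :: "(nat \<Rightarrow> complex) \<Rightarrow> (nat \<Rightarrow> nat) \<Rightarrow> real \<Rightarrow> nat \<Rightarrow> complex" where
  "shift_coeff d p \<theta> j = d j * (cis (- (p j * \<theta>)) - 1)"

lemma coanalytic_part_shift:
  "coanalytic_part d p J (z * cis \<theta>) = coanalytic_part d p J z + coanalytic_part (shift_coeff d p \<theta>) p J z"
proof -
  have "cnj (z * cis \<theta>) ^ k = cnj z ^ k * cis (- (k * \<theta>))" for k :: nat
    by (simp add: power_mult_distrib cis_cnj Complex.DeMoivre)
  then show ?thesis
    unfolding coanalytic_part_def shift_coeff_def sum.distrib[symmetric]
    by (intro sum.cong refl) (simp add: algebra_simps)
qed

lemma coanalytic_part_cis: "coanalytic_part d p J (cis t) = (\<Sum>j\<le>J. d j * cis (- (p j * t)))"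
  by (simp add: coanalytic_part_def cis_cnj Complex.DeMoivre)

lemma analytic_part_cis: "analytic_part a N (cis t) = (\<Sum>k\<le>N. a k * cis (k * t))"
  by (simp add: analytic_part_def Complex.DeMoivre)

lemma continuous_analytic_part [continuous_intros]:
  "continuous_on S f \<Longrightarrow> continuous_on S (\<lambda>x. analytic_part a N (f x))"
  unfolding analytic_part_def by (intro continuous_intros)

lemma continuous_coanalytic_part [continuous_intros]:
  "continuous_on S f \<Longrightarrow> continuous_on S (\<lambda>x. coanalytic_part d p J (f x))"
  unfolding coanalytic_part_def by (intro continuous_intros)

lemma holomorphic_analytic_part [holomorphic_intros]:
  "f holomorphic_on S \<Longrightarrow> (\<lambda>z. analytic_part a N (f z)) holomorphic_on S"
  unfolding analytic_part_def by (intro holomorphic_intros)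

text \<open>Positive frequencies allow a factor \<open>z\<close> to be split off without truncation
  in \<open>p j - 1\<close>. This is the shape in which \<open>integral_coanalytic_le\<close> takes
  the coanalytic part.\<close>

lemma coanalytic_part_eq_cnj:
  assumes "\<And>j. p j > 0"
  shows "coanalytic_part d p J z = cnj (z * (\<Sum>j\<le>J. cnj (d j) * z ^ (p j - 1)))"
proof -
  have "z * (\<Sum>j\<le>J. cnj (d j) * z ^ (p j - 1)) = (\<Sum>j\<le>J. cnj (d j) * z ^ p j)"
    unfolding sum_distrib_left
  proof (intro sum.cong refl)
    fix j
    obtain k where "p j = Suc k" using assms[of j] gr0_implies_Suc by blast
    then show "z * (cnj (d j) * z ^ (p j - 1)) = cnj (d j) * z ^ p j" by simp
  qed
  then show ?thesis by (simp add: coanalytic_part_def)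
qed

lemma trig_sum_eq_parts:
  assumes "strict_mono p" "\<And>j. b (p j) = d j" "\<And>k. k \<notin> range p \<Longrightarrow> b k = 0"
  shows "trig_sum a b (p J) x = analytic_part a (p J) (cis x) + coanalytic_part d p J (cis x)"
proof -
  have "(\<Sum>k\<le>p J. b k * cis (- (k * x))) = (\<Sum>j\<le>J. b (p j) * cis (- (p j * x)))"
    using assms by (intro sum_over_range) auto
  then show ?thesis
    by (simp add: trig_sum_def sum.distrib analytic_part_cis coanalytic_part_cis assms(2))
qed

lemma weighted_am_gm:
  fixes y E :: real
  assumes "E > 0" shows "y \<le> E / 2 + y\<^sup>2 / (2 * E)"
proof -
  have "y * (2 * E) \<le> y\<^sup>2 + E\<^sup>2" using sum_squares_bound[of y E] by (simp add: mult_ac)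
  then have "y \<le> (y\<^sup>2 + E\<^sup>2) / (2 * E)" using assms by (simp add: pos_le_divide_eq)
  also have "\<dots> = E / 2 + y\<^sup>2 / (2 * E)" using assms by (simp add: add_divide_distrib power2_eq_square)
  finally show ?thesis .
qed

text \<open>The factor of \<open>K\<close> from Abel summation: 10 for the partial sums, and 16
  times the coefficient bound \<open>2 * K\<close> times \<open>j0 + 3\<close> for the conjugated
  terms.\<close>

definition nontangential_const :: "nat \<Rightarrow> real" where
  "nontangential_const j0 = 10 + 32 * (j0 + 3)"

text \<open>Twice the mean-square constant \<open>10 * C1 ^ 2\<close> of the coanalytic part on the
  curve, plus a term for the first \<open>j0\<close> coefficients and the modulus of continuity,
  with \<open>4 * pi\<close> rounded up to 16.\<close>

definition coefficient_const :: "nat \<Rightarrow> real" where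
  "coefficient_const j0 = 20 * (nontangential_const j0)\<^sup>2 + 16 * (1 + 2 * real j0)\<^sup>2"

text \<open>The data at one stage: \<open>m\<close> is the frequency that the shift by \<open>\<theta>\<close> flips, \<open>\<beta>\<close> the resulting
amplitude of the increment, \<open>e\<close>, \<open>e1\<close> and \<open>\<epsilon>\<close> bound the errors, and \<open>g\<close> is the scale below which a
gap of \<open>A\<close> counts as good.\<close>

locale lacunary_stage = tent_curve t0 A for t0 :: real and A :: "real set" +
  fixes a b d :: "nat \<Rightarrow> complex" and p :: "nat \<Rightarrow> nat" and j0 J n m :: nat
    and \<theta> K g e e1 \<epsilon> :: real and \<beta> :: complex
  assumes lac: "\<And>j. j0 \<le> j \<Longrightarrow> 4 * p j \<le> p (Suc j)" and p_pos: "\<And>j. p j > 0" and p_mono: "strict_mono p"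
    and b_p: "\<And>j. b (p j) = d j" and b_off: "\<And>k. k \<notin> range p \<Longrightarrow> b k = 0"
    and K: "1 \<le> K" and d_le: "\<And>j. cmod (d j) \<le> 2 * K"
    and partial: "\<And>x k. x \<in> A \<Longrightarrow> k \<le> p J \<Longrightarrow> cmod (trig_sum a b k x) \<le> K"
    and partial_shift: "\<And>x k. x \<in> A \<Longrightarrow> k \<le> p J \<Longrightarrow> cmod (trig_sum a b k (x + \<theta>)) \<le> K"
    and increment: "\<And>x :: real. x \<in> A \<Longrightarrow>
      cmod (trig_sum a b (p J) (x + \<theta>) - trig_sum a b (p J) x - \<beta> * cis (- (m * x))) \<le> e"
    and m: "m > 0" and g: "g > 0" and e: "e \<ge> 0" and e1: "e1 \<ge> 0" and \<epsilon>: "\<epsilon> > 0"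
    and cutoff_small: "integral {t0..t0 + 2 * pi} (cutoff g) \<le> 2 / 25"
    and n: "j0 \<le> n" "n \<le> J"
    and low: "(\<Sum>j\<le>n. cmod (shift_coeff d p \<theta> j)) \<le> e1"
    and high: "\<And>j. n < j \<Longrightarrow> j \<le> J \<Longrightarrow> cmod (cis (- (p j * \<theta>)) - 1) \<le> \<epsilon>"
    and uc1: "\<And>z w. cmod z \<le> 1 \<Longrightarrow> cmod w \<le> 1 \<Longrightarrow> cmod (z - w) \<le> 5 * g \<Longrightarrow>
      cmod (coanalytic_part d p J z - coanalytic_part d p J w) \<le> 1"
    and uc2: "\<And>z w. cmod z \<le> 1 \<Longrightarrow> cmod w \<le> 1 \<Longrightarrow> cmod (z - w) \<le> 5 * g \<Longrightarrow>
      cmod (coanalytic_part (shift_coeff d p \<theta>) p J z - coanalytic_part (shift_coeff d p \<theta>) p J w) \<le> e"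
    and uc3: "\<And>z w. cmod z \<le> 1 \<Longrightarrow> cmod w \<le> 1 \<Longrightarrow> cmod (z - w) \<le> 5 * g \<Longrightarrow>
      cmod (z ^ m * (analytic_part a (p J) (z * cis \<theta>) - analytic_part a (p J) z) -
            w ^ m * (analytic_part a (p J) (w * cis \<theta>) - analytic_part a (p J) w)) \<le> e"
begin

abbreviation "d' \<equiv> shift_coeff d p \<theta>"
abbreviation "P \<equiv> analytic_part a (p J)"
abbreviation "R \<equiv> coanalytic_part d p J"
abbreviation "R' \<equiv> coanalytic_part d' p J"

abbreviation "C1 \<equiv> nontangential_const j0"
abbreviation "C2 \<equiv> coefficient_const j0"

section \<open>Bounds on the curve and the square sum of the coefficients\<close>

lemma nontangential_bound:
  assumes "\<And>k. k \<le> p J \<Longrightarrow> cmod (trig_sum a b k x) \<le> K"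
    and \<rho>: "0 < \<rho>" "\<rho> \<le> 1" and "\<bar>t - x\<bar> \<le> 8 * (1 - \<rho>)" and z: "z = of_real \<rho> * cis t"
  shows "cmod (P z + R z) \<le> C1 * K"
proof -
  have R: "R z = (\<Sum>k\<le>p J. b k * cnj z ^ k)"
    unfolding coanalytic_part_def b_p[symmetric]
    by (rule sum_over_range[symmetric, OF p_mono, where h = "\<lambda>k. b k * cnj z ^ k"]) (simp add: b_off)
  have "(\<Sum>k\<le>p J. cmod (b k) * (k * \<rho> ^ k * (1 - \<rho>))) = (\<Sum>j\<le>J. cmod (b (p j)) * (p j * \<rho> ^ p j * (1 - \<rho>)))"
    by (rule sum_over_range[OF p_mono]) (simp add: b_off)
  also have "\<dots> \<le> (\<Sum>j\<le>J. 2 * K * (p j * \<rho> ^ p j * (1 - \<rho>)))"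
    using \<rho> d_le by (intro sum_mono mult_right_mono) (auto simp: b_p)
  also have "\<dots> = 2 * K * (\<Sum>j\<le>J. p j * \<rho> ^ p j * (1 - \<rho>))"
    by (simp only: sum_distrib_left)
  also have "\<dots> \<le> 2 * K * (j0 + 3)"
    using K \<rho> lac by (intro mult_left_mono lacunary_abel_sum_le[of j0 p]) auto
  finally have "cmod (P z + R z) \<le> 10 * K + 16 * (2 * K * (j0 + 3))"
    using abel_nontangential_bound[of "p J" a b x K, OF assms(1) \<rho> assms(4) z]
    unfolding R analytic_part_def by linarith
  then show ?thesis by (simp add: nontangential_const_def algebra_simps)
qed

text \<open>The height \<open>mu t / 8\<close> of the tents is matched to Abel summation: for the
  nearest \<open>x\<close> in \<open>A\<close>, \<open>\<bar>t - x\<bar>\<close> equals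
  \<open>8 * (1 - rho t)\<close>.\<close>

lemma curve_bound: assumes "t \<in> period" shows "cmod (P (curve t) + R (curve t)) \<le> C1 * K"
proof -
  obtain x where "x \<in> A" "mu t = \<bar>t - x\<bar>" by (rule nearest)
  then show ?thesis
    using rho_bounds[OF assms] partial
    by (intro nontangential_bound[of x "rho t" t]) (auto simp: rho_def curve_def)
qed

lemma curve_bound_shift: 
  assumes "t \<in> period" shows "cmod (P (curve t * cis \<theta>) + R (curve t * cis \<theta>)) \<le> C1 * K"
proof -
  obtain x where "x \<in> A" "mu t = \<bar>t - x\<bar>" by (rule nearest)
  then show ?thesis
    using rho_bounds[OF assms] partial_shift
    by (intro nontangential_bound[of "x + \<theta>" "rho t" "t + \<theta>"]) (auto simp: rho_def curve_def mult.assoc cis_mult)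
qed

text \<open>The left side is the difference of \<open>P + R\<close> at two points differing by a
  rotation. Hence the increment of \<open>P\<close> and \<open>R'\<close> form a pair to which the
  coanalytic estimate applies.\<close>

lemma curve_bound_increment:
  assumes "t \<in> period"
  shows "cmod ((P (curve t * cis \<theta>) - P (curve t)) + R' (curve t)) \<le> 2 * C1 * K"
proof -
  have "(P (curve t * cis \<theta>) - P (curve t)) + R' (curve t) =
    (P (curve t * cis \<theta>) + R (curve t * cis \<theta>)) - (P (curve t) + R (curve t))"
    by (simp add: coanalytic_part_shift)
  also have "cmod \<dots> \<le> C1 * K + C1 * K"
    by (rule order_trans[OF norm_triangle_ineq4 add_mono[OF curve_bound_shift curve_bound]]) (rule assms)+
  finally show ?thesis by (simp add: mult_ac)
qed

lemma integral_R_le: "integral period (\<lambda>t. (cmod (R (curve t)))\<^sup>2) \<le> 10 * (C1 * K)\<^sup>2"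
proof -
  let ?Q = "\<lambda>z. \<Sum>j\<le>J. cnj (d j) * z ^ (p j - 1)"
  have "integral period (\<lambda>t. (cmod (curve t * ?Q (curve t)))\<^sup>2) \<le> 10 * (C1 * K)\<^sup>2"
  proof (rule integral_coanalytic_le[where P = P and r = 2])
    show "cmod (P (curve t) + cnj (curve t * ?Q (curve t))) \<le> C1 * K" if "t \<in> period" for t
      using curve_bound[OF that] by (simp only: coanalytic_part_eq_cnj[OF p_pos])
  qed (auto intro!: holomorphic_intros)
  then show ?thesis by (simp only: coanalytic_part_eq_cnj[OF p_pos] complex_mod_cnj)
qed

lemma integral_R'_le: "integral period (\<lambda>t. (cmod (R' (curve t)))\<^sup>2) \<le> 10 * (2 * C1 * K)\<^sup>2"
proof -
  let ?Q = "\<lambda>z. \<Sum>j\<le>J. cnj (d' j) * z ^ (p j - 1)"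
  have "integral period (\<lambda>t. (cmod (curve t * ?Q (curve t)))\<^sup>2) \<le> 10 * (2 * C1 * K)\<^sup>2"
  proof (rule integral_coanalytic_le[where P = "\<lambda>z. P (z * cis \<theta>) - P z" and r = 2])
    show "cmod ((P (curve t * cis \<theta>) - P (curve t)) + cnj (curve t * ?Q (curve t))) \<le> 2 * C1 * K" if "t \<in> period" for t
      using curve_bound_increment[OF that] by (simp only: coanalytic_part_eq_cnj[OF p_pos])
  qed (auto intro!: holomorphic_intros)
  then show ?thesis by (simp only: coanalytic_part_eq_cnj[OF p_pos] complex_mod_cnj)
qed

lemma near_boundary:
  assumes "t \<in> period" "mu t \<le> 4 * g" shows "cmod (cis t - curve t) \<le> g / 2"
proof -
  have "cis t - curve t = of_real (mu t / 8) * cis t" by (simp add: curve_def rho_def algebra_simps)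
  then have "cmod (cis t - curve t) = cmod (of_real (mu t / 8) * cis t)" by (simp only:)
  also have "\<dots> = mu t / 8" using mu_nonneg by (simp add: norm_mult)
  finally have "cmod (cis t - curve t) = mu t / 8" .
  then show ?thesis using assms(2) by simp
qed

text \<open>Close to good points the lacunary sum \<open>h\<close> is compared with \<open>R\<close>
  on the curve, whose mean square is bounded. Over larger gaps the fourth moment limits its
  contribution to a fraction of its total square integral, which is then absorbed.\<close>

lemma square_sum_coefficients_le: "(\<Sum>j\<in>{j0..J}. (cmod (d j))\<^sup>2) \<le> C2 * K\<^sup>2"
proof -
  define s where "s = (\<Sum>j\<in>{j0..J}. (cmod (d j))\<^sup>2)"
  define h where "h t = (\<Sum>j\<in>{j0..J}. d j * cis (- (p j * t)))" for t :: real
  \<comment> \<open>1 for the passage from the circle to the curve, and \<open>2 * K\<close> for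
    each of the \<open>j0\<close> coefficients missing from \<open>h\<close>.\<close>
  define D where "D = 1 + 2 * K * j0"
  have s0: "s \<ge> 0" by (auto simp: s_def intro: sum_nonneg)
  have cont_h: "continuous_on S h" for S unfolding h_def by (intro continuous_intros)
  have parseval: "((\<lambda>t. (cmod (h t))\<^sup>2) has_integral 2 * pi * s) period"
    using has_integral_parseval[of "{j0..J}" "\<lambda>j. - int (p j)" d t0] p_mono
    by (auto simp: h_def s_def inj_on_def strict_mono_eq)
  have power4: "integral period (\<lambda>t. cmod (h t) ^ 4) \<le> 4 * pi * s\<^sup>2"
    unfolding h_def s_def by (rule integral_lacunary_power4[OF lac p_pos p_mono])
  have pointwise: "(cmod (h t))\<^sup>2 \<le> 2 * (cmod (R (curve t)))\<^sup>2 + 2 * D\<^sup>2 + (cmod (h t) ^ 4 / (4 * s) + s * cutoff g t)"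
    if t: "t \<in> period" and "s > 0" for t
  proof (cases "mu t \<le> 4 * g")
    case True
    have J: "{..J} = {..<j0} \<union> {j0..J}" using n by auto
    have "R (cis t) = (\<Sum>j<j0. d j * cis (- (p j * t))) + h t"
      unfolding coanalytic_part_cis h_def J by (rule sum.union_disjoint) auto
    moreover have "cmod (\<Sum>j<j0. d j * cis (- (p j * t))) \<le> (\<Sum>j<j0. 2 * K)"
      using d_le by (intro sum_norm_le) (simp add: norm_mult)
    moreover have "cmod (R (cis t) - R (curve t)) \<le> 1"
      using near_boundary[OF t True] g norm_curve_le[OF t] by (intro uc1) auto
    ultimately have "cmod (h t) \<le> cmod (R (curve t)) + D"
      using norm_triangle_ineq4[of "R (cis t)" "\<Sum>j<j0. d j * cis (- (p j * t))"]
        norm_triangle_ineq2[of "R (cis t)" "R (curve t)"] by (simp add: D_def mult_ac)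
    then have "(cmod (h t))\<^sup>2 \<le> (cmod (R (curve t)) + D)\<^sup>2" by (intro power_mono) auto
    also have "\<dots> \<le> 2 * (cmod (R (curve t)))\<^sup>2 + 2 * D\<^sup>2"
      using zero_le_power2[of "cmod (R (curve t)) - D"] by (simp add: power2_eq_square algebra_simps)
    moreover have "0 \<le> cmod (h t) ^ 4 / (4 * s) + s * cutoff g t"
      using s0 cutoff_bounds by auto
    ultimately show ?thesis by linarith
  next
    case False
    \<comment> \<open>The weight \<open>2 * s\<close> makes the fourth moment contribute at most
      \<open>pi * s\<close>, half of the total \<open>2 * pi * s\<close> in Parseval's
      identity.\<close>
    then have "cutoff g t = 1" using g by (intro cutoff_eq_1) auto
    have "(cmod (h t))\<^sup>2 \<le> s + cmod (h t) ^ 4 / (4 * s)"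
      using weighted_am_gm[of "2 * s" "(cmod (h t))\<^sup>2"] \<open>s > 0\<close> by (simp flip: power_mult)
    then show ?thesis
      unfolding \<open>cutoff g t = 1\<close> mult_1_right
      using zero_le_power2[of "cmod (R (curve t))"] zero_le_power2[of D] by linarith
  qed
  show ?thesis
  proof (cases "s > 0")
    case True
    have i1: "(\<lambda>t. (cmod (R (curve t)))\<^sup>2) integrable_on period"
      and i2: "(\<lambda>t. cmod (h t) ^ 4) integrable_on period" and i3: "cutoff g integrable_on period"
      by (intro integrable_continuous_real continuous_intros cont_h continuous_cutoff g)+
    have "2 * pi * s \<le> 2 * integral period (\<lambda>t. (cmod (R (curve t)))\<^sup>2) + 2 * D\<^sup>2 * (2 * pi) +
       (integral period (\<lambda>t. cmod (h t) ^ 4) / (4 * s) + s * integral period (cutoff g))"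
    proof (rule has_integral_le[OF parseval _ pointwise[OF _ True]])
      show "((\<lambda>t. 2 * (cmod (R (curve t)))\<^sup>2 + 2 * D\<^sup>2 + (cmod (h t) ^ 4 / (4 * s) + s * cutoff g t)) has_integral
        2 * integral period (\<lambda>t. (cmod (R (curve t)))\<^sup>2) + 2 * D\<^sup>2 * (2 * pi) +
         (integral period (\<lambda>t. cmod (h t) ^ 4) / (4 * s) + s * integral period (cutoff g))) period"
        using has_integral_const_real[of "2 * D\<^sup>2" t0 "t0 + 2 * pi"]
        by (intro has_integral_add has_integral_mult_right has_integral_divide integrable_integral i1 i2 i3)
          (simp add: mult_ac)
    qed
    also have "\<dots> \<le> 2 * (10 * (C1 * K)\<^sup>2) + 2 * D\<^sup>2 * (2 * pi) + (4 * pi * s\<^sup>2 / (4 * s) + s * (2 / 25))"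
      using True by (intro add_mono mult_left_mono divide_right_mono integral_R_le power4 cutoff_small) auto
    also have "4 * pi * s\<^sup>2 / (4 * s) = pi * s" using True by (simp add: power2_eq_square)
    finally have "(pi - 2 / 25) * s \<le> 20 * (C1 * K)\<^sup>2 + 4 * pi * D\<^sup>2" by (simp add: algebra_simps)
    \<comment> \<open>After absorption of \<open>pi * s\<close> and \<open>2 / 25 * s\<close>, at
      least one full \<open>s\<close> remains on the left.\<close>
    moreover have "1 * s \<le> (pi - 2 / 25) * s" using True pi_gt3 by (intro mult_right_mono) auto
    moreover have "4 * pi * D\<^sup>2 \<le> 16 * D\<^sup>2" using pi_less_4 by (intro mult_right_mono) auto
    moreover have "D\<^sup>2 \<le> ((1 + 2 * real j0) * K)\<^sup>2"
      using K by (intro power_mono) (auto simp: D_def algebra_simps)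
    ultimately have "s \<le> 20 * (C1 * K)\<^sup>2 + 16 * ((1 + 2 * real j0) * K)\<^sup>2" by linarith
    also have "\<dots> = C2 * K\<^sup>2" unfolding coefficient_const_def power_mult_distrib distrib_right[of _ _ "K\<^sup>2"] by (simp only: mult.assoc)
    finally show ?thesis by (simp only: s_def)
  next
    case False
    moreover have "0 \<le> C2 * K\<^sup>2" by (simp add: coefficient_const_def)
    ultimately show ?thesis by (simp add: s_def)
  qed
qed

section \<open>The increment of the analytic part and the inequality it satisfies\<close>

definition tail :: "real \<Rightarrow> complex" where "tail t = (\<Sum>j\<in>{n<..J}. d' j * cis (- (real (p j) * t)))"

lemma continuous_tail: "continuous_on S tail"
  unfolding tail_def by (intro continuous_intros)

text \<open>Beyond \<open>n\<close> the shift multiplies coefficients by at most \<epsilon>, so the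
  square sum is at most \<open>\<epsilon>\<^sup>2 * C2 * K\<^sup>2\<close>. The passage from mean
  square to mean uses the weighted inequality at the scale \<open>\<epsilon> * K\<close>.\<close>

lemma integral_tail_le: "integral period (\<lambda>t. cmod (tail t)) \<le> pi * \<epsilon> * K * (1 + C2)"
proof -
  have "(\<Sum>j\<in>{n<..J}. (cmod (d' j))\<^sup>2) \<le> (\<Sum>j\<in>{n<..J}. \<epsilon>\<^sup>2 * (cmod (d j))\<^sup>2)"
  proof (intro sum_mono)
    fix j assume "j \<in> {n<..J}"
    then have "cmod (d' j) \<le> cmod (d j) * \<epsilon>"
      unfolding shift_coeff_def norm_mult by (intro mult_left_mono high) auto
    then show "(cmod (d' j))\<^sup>2 \<le> \<epsilon>\<^sup>2 * (cmod (d j))\<^sup>2"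
      using power_mono[of "cmod (d' j)" "cmod (d j) * \<epsilon>" 2] by (simp add: power_mult_distrib mult.commute)
  qed
  also have "\<dots> \<le> \<epsilon>\<^sup>2 * (\<Sum>j\<in>{j0..J}. (cmod (d j))\<^sup>2)"
    unfolding sum_distrib_left[symmetric] using n by (intro mult_left_mono sum_mono2) auto
  also have "\<dots> \<le> \<epsilon>\<^sup>2 * (C2 * K\<^sup>2)"
    by (intro mult_left_mono square_sum_coefficients_le) auto
  finally have sq: "(\<Sum>j\<in>{n<..J}. (cmod (d' j))\<^sup>2) \<le> \<epsilon>\<^sup>2 * (C2 * K\<^sup>2)" .
  have parseval: "((\<lambda>t. (cmod (tail t))\<^sup>2) has_integral 2 * pi * (\<Sum>j\<in>{n<..J}. (cmod (d' j))\<^sup>2)) period"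
    using has_integral_parseval[of "{n<..J}" "\<lambda>j. - int (p j)" d' t0] p_mono
    by (auto simp: tail_def inj_on_def strict_mono_eq)
  have pos: "\<epsilon> * K > 0" using \<epsilon> K by simp
  have "integral period (\<lambda>t. cmod (tail t)) \<le>
     (\<epsilon> * K / 2) * (2 * pi) + (2 * pi * (\<Sum>j\<in>{n<..J}. (cmod (d' j))\<^sup>2)) / (2 * (\<epsilon> * K))"
  proof (rule has_integral_le)
    show "((\<lambda>t. cmod (tail t)) has_integral integral period (\<lambda>t. cmod (tail t))) period"
      by (intro integrable_integral integrable_continuous_real continuous_intros continuous_tail)
    show "((\<lambda>t. \<epsilon> * K / 2 + (cmod (tail t))\<^sup>2 / (2 * (\<epsilon> * K))) has_integral
      (\<epsilon> * K / 2) * (2 * pi) + (2 * pi * (\<Sum>j\<in>{n<..J}. (cmod (d' j))\<^sup>2)) / (2 * (\<epsilon> * K))) period"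
      using has_integral_const_real[of "\<epsilon> * K / 2" t0 "t0 + 2 * pi"]
      by (intro has_integral_add has_integral_divide parseval) (simp add: mult_ac)
    fix t
    show "cmod (tail t) \<le> \<epsilon> * K / 2 + (cmod (tail t))\<^sup>2 / (2 * (\<epsilon> * K))"
      by (rule weighted_am_gm[OF pos])
  qed
  also have "\<dots> \<le> (\<epsilon> * K / 2) * (2 * pi) + (2 * pi * (\<epsilon>\<^sup>2 * (C2 * K\<^sup>2))) / (2 * (\<epsilon> * K))"
    using sq pos by (intro add_left_mono divide_right_mono mult_left_mono) auto
  also have "\<dots> = pi * \<epsilon> * K * (1 + C2)"
    using pos by (simp add: field_simps power2_eq_square)
  finally show ?thesis .
qed

text \<open>The factor \<open>z ^ m\<close> turns the expected increment
  \<open>\<beta> * cis (- m * x)\<close> into the constant \<beta>, and makes \<open>X\<close>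
  vanish at 0.\<close>

definition X :: "complex \<Rightarrow> complex" where "X z = z ^ m * (P (z * cis \<theta>) - P z)"

text \<open>The value is carried to the nearest good point \<open>x\<close>, where the increment is
  known up to \<open>R'\<close>. Then \<open>R'\<close> is carried from \<open>cis x\<close> to
  \<open>cis t\<close>, so that the error is a function of \<open>t\<close> that can be integrated.
  The two passages and the increment cost \<open>e\<close> each, and the low frequencies cost
  \<open>e1\<close>.\<close>

lemma X_good:
  assumes t: "t \<in> period" and near: "mu t \<le> 4 * g"
  shows "cmod (X (curve t) - \<beta>) \<le> 3 * e + e1 + cmod (tail t)"
proof -
  obtain x where x: "x \<in> A" "mu t = \<bar>t - x\<bar>" by (rule nearest)
  have tx: "cmod (cis t - cis x) \<le> 4 * g"
    using cmod_cis_diff_le[of t x] x(2) near by simp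
  have "cmod (curve t - cis x) \<le> cmod (cis t - curve t) + cmod (cis t - cis x)"
    using norm_triangle_ineq4[of "cis t - cis x" "cis t - curve t"] by (simp add: add.commute)
  then have "cmod (curve t - cis x) \<le> 5 * g"
    using tx near_boundary[OF t near] g by linarith
  then have 1: "cmod (X (curve t) - X (cis x)) \<le> e"
    unfolding X_def using norm_curve_le[OF t] by (intro uc3) auto
  have 2: "cmod (R' (cis x) - R' (cis t)) \<le> e"
    using tx g by (intro uc2) (auto simp: norm_minus_commute)
  have S: "trig_sum a b (p J) y = P (cis y) + R (cis y)" for y
    by (rule trig_sum_eq_parts[OF p_mono]) (rule b_p, erule b_off)
  have X: "X (cis x) - \<beta> = cis (m * x) *
     ((trig_sum a b (p J) (x + \<theta>) - trig_sum a b (p J) x - \<beta> * cis (- (m * x))) - R' (cis x))"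
  proof -
    have "P (cis x * cis \<theta>) - P (cis x) = trig_sum a b (p J) (x + \<theta>) - trig_sum a b (p J) x - R' (cis x)"
      unfolding S by (simp add: coanalytic_part_shift flip: cis_mult)
    moreover have "cis (m * x) * cis (- (m * x)) = 1" by (simp add: cis_mult)
    ultimately have "X (cis x) = cis (m * x) * (trig_sum a b (p J) (x + \<theta>) - trig_sum a b (p J) x - R' (cis x))"
      and "cis (m * x) * (\<beta> * cis (- (m * x))) = \<beta>"
      by (simp_all add: X_def Complex.DeMoivre mult.left_commute)
    moreover have "c * ((U - v) - r) = c * (U - r) - c * v" for c U v r :: complex
      by (simp add: algebra_simps)
    ultimately show ?thesis by (simp only:)
  qed
  have 3: "cmod (X (cis x) - \<beta>) \<le> e + cmod (R' (cis x))"
    unfolding X norm_mult norm_cis mult_1_left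
    by (rule order_trans[OF norm_triangle_ineq4 add_right_mono[OF increment[OF x(1)]]])
  have J: "{..J} = {..n} \<union> {n<..J}" using n by auto
  have "R' (cis t) = (\<Sum>j\<le>n. d' j * cis (- (p j * t))) + tail t"
    unfolding coanalytic_part_cis tail_def J by (rule sum.union_disjoint) auto
  moreover have "cmod (\<Sum>j\<le>n. d' j * cis (- (p j * t))) \<le> e1"
    by (rule order_trans[OF norm_sum]) (use low in \<open>simp add: norm_mult\<close>)
  ultimately have 4: "cmod (R' (cis t)) \<le> e1 + cmod (tail t)"
    by (simp only:) (rule order_trans[OF norm_triangle_ineq add_right_mono])
  have "cmod (R' (cis x)) \<le> e + cmod (R' (cis t))"
    using norm_triangle_ineq2[of "R' (cis x)" "R' (cis t)"] 2 by linarith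
  moreover have "cmod (X (curve t) - \<beta>) \<le> cmod (X (curve t) - X (cis x)) + cmod (X (cis x) - \<beta>)"
    using norm_triangle_ineq[of "X (curve t) - X (cis x)" "X (cis x) - \<beta>"] by simp
  ultimately show ?thesis using 1 3 4 by linarith
qed

lemma X_le:
  assumes t: "t \<in> period"
  shows "cmod (X (curve t) - \<beta>) \<le> 2 * C1 * K + cmod \<beta> + cmod (R' (curve t))"
proof -
  have "cmod (P (curve t * cis \<theta>) - P (curve t)) \<le> 2 * C1 * K + cmod (R' (curve t))"
    using norm_triangle_ineq2[of "P (curve t * cis \<theta>) - P (curve t)" "- R' (curve t)"]
      curve_bound_increment[OF t] by simp
  moreover have "cmod (X (curve t)) \<le> 1 * cmod (P (curve t * cis \<theta>) - P (curve t))"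
    unfolding X_def norm_mult norm_power
    using norm_curve_le[OF t] by (intro mult_right_mono power_le_one) auto
  ultimately show ?thesis using norm_triangle_ineq4[of "X (curve t)" \<beta>] by linarith
qed

text \<open>Integrate \<open>(X - \<beta>) * W * nu\<close> over the curve. As \<open>X\<close>
  vanishes at 0, the result is \<open>- 2 * pi * \<beta> * W 0\<close>. On the good part the
  integrand is small because \<open>X\<close> is near \<beta>, on the rest because \<open>W\<close>
  is at most \<open>x\<^sup>2\<close>.\<close>

lemma main_estimate:
  assumes x: "0 < x" "x \<le> 1"
  shows "2 * pi * cmod \<beta> * x \<le> 5 / 4 * (2 * pi * (3 * e + e1) + pi * \<epsilon> * K * (1 + C2)
      + x\<^sup>2 * (2 * pi * (2 * C1 * K + cmod \<beta> + 1) + 10 * (2 * C1 * K)\<^sup>2))"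
proof -
  \<comment> \<open>Chosen so that \<open>exp (- (2 / 25) * L) = x\<close>, the guaranteed size of
    \<open>W\<close> at 0.\<close>
  define L where "L = - (25 / 2 * ln x)"
  have L: "L \<ge> 0" using x by (simp add: L_def)
  have expL: "exp (- (2 / 25 * L)) = x" using x by (simp add: L_def)
  obtain W where W: "W holomorphic_on ball 0 (1 + g)" "\<And>z. cmod z \<le> 1 \<Longrightarrow> cmod (W z) \<le> 1"
    "\<And>t. t \<in> period \<Longrightarrow> 4 * g \<le> mu t \<Longrightarrow> cmod (W (curve t)) \<le> exp (- (8 / 49 * L))"
    "exp (- (L * integral period (cutoff g))) \<le> cmod (W 0)"
    using damping_function[OF g L] by metis
  have W0: "x \<le> cmod (W 0)"
  proof -
    have "exp (- (2 / 25 * L)) \<le> exp (- (L * integral period (cutoff g)))"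
      using mult_left_mono[OF cutoff_small L] by simp
    with expL W(4) show ?thesis by simp
  qed
  have Wfar: "cmod (W (curve t)) \<le> x\<^sup>2" if "t \<in> period" "4 * g \<le> mu t" for t
  proof -
    \<comment> \<open>Here \<open>8 / 49 > 4 / 25\<close> turns the decay over the gaps into the
      square of \<open>x\<close>.\<close>
    have "exp (- (8 / 49 * L)) \<le> exp (2 * (- (2 / 25 * L)))" using L by simp
    also have "\<dots> = x\<^sup>2" unfolding exp_double expL ..
    finally show ?thesis using W(3)[OF that] by simp
  qed
  define G where "G t = 3 * e + e1 + cmod (tail t)" for t
  \<comment> \<open>The bound of \<open>cmod (R' (curve t))\<close> by 1 plus its square allows the
    mean-square estimate to be used directly.\<close>
  define F where "F t = 2 * C1 * K + cmod \<beta> + 1 + (cmod (R' (curve t)))\<^sup>2" for t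
  define B where "B t = 5 / 4 * (G t + x\<^sup>2 * F t)" for t
  have G0: "0 \<le> G t" and F0: "0 \<le> x\<^sup>2 * F t" for t
    using K e e1 by (auto simp: G_def F_def nontangential_const_def intro!: mult_nonneg_nonneg add_nonneg_nonneg)
  have pw: "cmod ((X (curve t) - \<beta>) * W (curve t) * nu t) \<le> B t" if t: "t \<in> period" for t
  proof -
    have "cmod ((X (curve t) - \<beta>) * W (curve t)) \<le> G t + x\<^sup>2 * F t"
    proof (cases "mu t \<le> 4 * g")
      case True
      have "cmod ((X (curve t) - \<beta>) * W (curve t)) \<le> G t * 1"
        unfolding norm_mult using X_good[OF t True] W(2)[OF norm_curve_le[OF t]] G0[of t]
        by (intro mult_mono) (auto simp: G_def)
      then show ?thesis using F0[of t] by linarith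
    next
      case False
      have "cmod (R' (curve t)) \<le> 1 + (cmod (R' (curve t)))\<^sup>2"
        using weighted_am_gm[of 1 "cmod (R' (curve t))"] zero_le_power2[of "cmod (R' (curve t))"] by linarith
      with X_le[OF t] have "cmod (X (curve t) - \<beta>) \<le> F t"
        unfolding F_def by linarith
      then have "cmod ((X (curve t) - \<beta>) * W (curve t)) \<le> F t * x\<^sup>2"
        unfolding norm_mult using Wfar[OF t] False order_trans[OF norm_ge_zero, of "X (curve t) - \<beta>"]
        by (intro mult_mono) auto
      then show ?thesis using G0[of t] by (simp add: mult.commute)
    qed
    then have "cmod ((X (curve t) - \<beta>) * W (curve t)) * cmod (nu t) \<le> (G t + x\<^sup>2 * F t) * (5 / 4)"
      using norm_nu[OF t] G0[of t] F0[of t] by (intro mult_mono) auto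
    then show ?thesis unfolding B_def norm_mult[of "_ * _" "nu t"] by (simp only: mult.commute)
  qed
  \<comment> \<open>One factor \<open>z\<close> of \<open>z ^ m\<close> is reserved for the line
    element; \<open>m > 0\<close> makes this possible.\<close>
  have "((\<lambda>t. curve t * ((curve t ^ (m - 1) * (P (curve t * cis \<theta>) - P (curve t))) * W (curve t)) * nu t) has_integral 0) period"
    using g by (intro has_integral_curve_0[where r = "1 + g" and \<Phi> = "\<lambda>z. (z ^ (m - 1) * (P (z * cis \<theta>) - P z)) * W z"]
        holomorphic_intros W) auto
  moreover have "curve t * ((curve t ^ (m - 1) * (P (curve t * cis \<theta>) - P (curve t))) * W (curve t)) = X (curve t) * W (curve t)" for t
    using m by (simp add: X_def power_eq_if)
  ultimately have "((\<lambda>t. X (curve t) * W (curve t) * nu t) has_integral 0) period" by (simp only:)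
  moreover have "((\<lambda>t. W (curve t) * nu t) has_integral 2 * pi * W 0) period"
    using g by (intro has_integral_curve[OF W(1)]) simp
  ultimately have "((\<lambda>t. X (curve t) * W (curve t) * nu t - \<beta> * (W (curve t) * nu t)) has_integral 0 - \<beta> * (2 * pi * W 0)) period"
    by (intro has_integral_diff has_integral_mult_right)
  then have main: "((\<lambda>t. (X (curve t) - \<beta>) * W (curve t) * nu t) has_integral - (\<beta> * (2 * pi * W 0))) period"
    by (simp add: algebra_simps)
  have const: "((\<lambda>t. c) has_integral c * (2 * pi)) period" for c :: real
    using has_integral_const_real[of c t0 "t0 + 2 * pi"] by (simp add: mult.commute)
  have it: "(\<lambda>t. cmod (tail t)) integrable_on period" and iR: "(\<lambda>t. (cmod (R' (curve t)))\<^sup>2) integrable_on period"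
    by (intro integrable_continuous_real continuous_intros continuous_tail)+
  have B: "(B has_integral 5 / 4 * (((3 * e + e1) * (2 * pi) + integral period (\<lambda>t. cmod (tail t))) +
     x\<^sup>2 * ((2 * C1 * K + cmod \<beta> + 1) * (2 * pi) + integral period (\<lambda>t. (cmod (R' (curve t)))\<^sup>2)))) period"
    unfolding B_def[abs_def] G_def F_def
    by (rule has_integral_mult_right[OF has_integral_add[OF
          has_integral_add[OF const integrable_integral[OF it]]
          has_integral_mult_right[OF has_integral_add[OF const integrable_integral[OF iR]]]]])
  have "2 * pi * cmod \<beta> * x \<le> 2 * pi * cmod \<beta> * cmod (W 0)" by (intro mult_left_mono W0) auto
  also have "\<dots> = cmod (- (\<beta> * (2 * pi * W 0)))" by (simp add: norm_mult)
  also have "\<dots> = cmod (integral period (\<lambda>t. (X (curve t) - \<beta>) * W (curve t) * nu t))"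
    using main by (simp add: integral_unique)
  also have "\<dots> \<le> integral period B"
    using main B pw by (intro integral_norm_bound_integral) auto
  also have "\<dots> = 5 / 4 * (((3 * e + e1) * (2 * pi) + integral period (\<lambda>t. cmod (tail t))) +
     x\<^sup>2 * ((2 * C1 * K + cmod \<beta> + 1) * (2 * pi) + integral period (\<lambda>t. (cmod (R' (curve t)))\<^sup>2)))"
    using B by (rule integral_unique)
  also have "\<dots> \<le> 5 / 4 * (((3 * e + e1) * (2 * pi) + pi * \<epsilon> * K * (1 + C2)) +
     x\<^sup>2 * ((2 * C1 * K + cmod \<beta> + 1) * (2 * pi) + 10 * (2 * C1 * K)\<^sup>2))"
    using x by (intro mult_left_mono add_mono integral_tail_le integral_R'_le order_refl) auto
  finally show ?thesis by (simp add: mult.commute)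
qed

end

subsection \<open>Almost everywhere convergence\<close>

lemma decseq_negligible_measure_small:
  fixes D :: "nat \<Rightarrow> real set"
  assumes meas: "\<And>k. D k \<in> lmeasurable" and dec: "decseq D" and null: "negligible (\<Inter>k. D k)" and "\<delta> > 0"
  shows "\<exists>k. measure lebesgue (D k) < \<delta>"
proof -
  have "(\<lambda>k. measure lebesgue (D k)) \<longlonglongrightarrow> measure lebesgue (\<Inter>k. D k)"
  proof (rule Lim_measure_decseq)
    show "range D \<subseteq> sets lebesgue" using meas by (auto simp: fmeasurableD)
    show "emeasure lebesgue (D k) \<noteq> \<infinity>" for k using fmeasurableD2[OF meas[of k]] unfolding infinity_ennreal_def .
  qed (rule dec)
  moreover have "measure lebesgue (\<Inter>k. D k) = 0"
    using null by (simp add: negligible_imp_measure0)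
  ultimately have "eventually (\<lambda>k. measure lebesgue (D k) < \<delta>) sequentially"
    using \<open>\<delta> > 0\<close> by (intro order_tendstoD) auto
  then show ?thesis by (auto simp: eventually_sequentially)
qed

lemma lmeasurable_exceed:
  fixes g :: "nat \<Rightarrow> real \<Rightarrow> complex"
  assumes "\<And>n. continuous_on UNIV (g n)"
  shows "{t\<in>{u..v}. \<exists>n\<ge>M. r < cmod (g n t)} \<in> lmeasurable"
proof (rule bounded_set_imp_lmeasurable)
  show "bounded {t\<in>{u..v}. \<exists>n\<ge>M. r < cmod (g n t)}"
    by (rule bounded_subset[of "{u..v}"]) auto
  have "{t\<in>{u..v}. \<exists>n\<ge>M. r < cmod (g n t)} = {u..v} \<inter> (\<Union>n\<in>{M..}. {t. r < cmod (g n t)})"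
    by auto
  moreover have "open {t. r < cmod (g n t)}" for n
    by (intro open_Collect_less continuous_intros assms)
  ultimately show "{t\<in>{u..v}. \<exists>n\<ge>M. r < cmod (g n t)} \<in> sets lebesgue"
    by auto
qed

text \<open>A quantitative form of Egorov's theorem: the sets where some later term exceeds
  \<open>r\<close> decrease, and their intersection lies in the set of divergence from 0.\<close>

lemma convergence_in_measure:
  fixes g :: "nat \<Rightarrow> real \<Rightarrow> complex"
  assumes cont: "\<And>n. continuous_on UNIV (g n)"
    and null: "negligible {t\<in>{u..v}. \<not> (\<lambda>n. g n t) \<longlonglongrightarrow> 0}" and "r > 0" "\<delta> > 0"
  shows "\<exists>M. measure lebesgue {t\<in>{u..v}. \<exists>n\<ge>M. r < cmod (g n t)} < \<delta>"
proof (rule decseq_negligible_measure_small[OF lmeasurable_exceed[OF cont] _ _ \<open>\<delta> > 0\<close>])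
  show "decseq (\<lambda>M. {t\<in>{u..v}. \<exists>n\<ge>M. r < cmod (g n t)})"
    unfolding decseq_def by (auto intro: order_trans)
  have sub: "t \<in> {t\<in>{u..v}. \<not> (\<lambda>n. g n t) \<longlonglongrightarrow> 0}"
    if t: "t \<in> (\<Inter>M. {t\<in>{u..v}. \<exists>n\<ge>M. r < cmod (g n t)})" for t
  proof -
    have "\<not> (\<lambda>n. g n t) \<longlonglongrightarrow> 0"
    proof
      assume "(\<lambda>n. g n t) \<longlonglongrightarrow> 0"
      then obtain M where "\<forall>n\<ge>M. cmod (g n t) < r"
        using \<open>r > 0\<close> unfolding LIMSEQ_iff by fastforce
      moreover obtain n where "n \<ge> M" "r < cmod (g n t)" using t by auto
      ultimately show False by fastforce
    qed
    then show ?thesis using t by auto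
  qed
  show "negligible (\<Inter>M. {t\<in>{u..v}. \<exists>n\<ge>M. r < cmod (g n t)})"
    by (rule negligible_subset[OF null]) (rule subsetI, rule sub)
qed

text \<open>Where the sequence converges it is bounded, so the sets where it exceeds increasing
  levels decrease to a null set.\<close>

lemma maximal_function_bounded:
  fixes S :: "nat \<Rightarrow> real \<Rightarrow> complex"
  assumes cont: "\<And>n. continuous_on UNIV (S n)"
    and null: "negligible {t\<in>{u..v}. \<not> convergent (\<lambda>n. S n t)}" and "\<delta> > 0"
  shows "\<exists>K\<ge>1. measure lebesgue {t\<in>{u..v}. \<exists>n. K < cmod (S n t)} < \<delta>"
proof -
  have "\<exists>k. measure lebesgue {t\<in>{u..v}. \<exists>n\<ge>0. real (Suc k) < cmod (S n t)} < \<delta>"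
  proof (rule decseq_negligible_measure_small[OF lmeasurable_exceed[OF cont] _ _ \<open>\<delta> > 0\<close>])
    show "decseq (\<lambda>k. {t\<in>{u..v}. \<exists>n\<ge>0. real (Suc k) < cmod (S n t)})"
    proof (rule decseq_SucI, rule subsetI)
      fix k t assume "t \<in> {t\<in>{u..v}. \<exists>n\<ge>0. real (Suc (Suc k)) < cmod (S n t)}"
      then obtain n where t: "t \<in> {u..v}" "real (Suc (Suc k)) < cmod (S n t)" by blast
      then have "real (Suc k) < cmod (S n t)" by simp
      then show "t \<in> {t\<in>{u..v}. \<exists>n\<ge>0. real (Suc k) < cmod (S n t)}" using t(1) by blast
    qed
    have sub: "t \<in> {t\<in>{u..v}. \<not> convergent (\<lambda>n. S n t)}"
      if t: "t \<in> (\<Inter>k. {t\<in>{u..v}. \<exists>n\<ge>0. real (Suc k) < cmod (S n t)})" for t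
    proof -
      have "\<not> convergent (\<lambda>n. S n t)"
      proof
        assume "convergent (\<lambda>n. S n t)"
        then have "Bseq (\<lambda>n. S n t)" by (rule convergent_imp_Bseq)
        then obtain B where B: "\<And>n. cmod (S n t) \<le> B" by (rule BseqE) blast
        obtain k :: nat where "B \<le> real k" using real_arch_simple by blast
        moreover obtain n where "real (Suc k) < cmod (S n t)" using t by blast
        ultimately show False using B[of n] by simp
      qed
      then show ?thesis using t by auto
    qed
    show "negligible (\<Inter>k. {t\<in>{u..v}. \<exists>n\<ge>0. real (Suc k) < cmod (S n t)})"
      by (rule negligible_subset[OF null]) (rule subsetI, rule sub)
  qed
  then obtain k where "measure lebesgue {t\<in>{u..v}. \<exists>n\<ge>0. real (Suc k) < cmod (S n t)} < \<delta>" ..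
  then have "measure lebesgue {t\<in>{u..v}. \<exists>n. real (Suc k) < cmod (S n t)} < \<delta>"
    by (simp only: le0 simp_thms)
  moreover have "1 \<le> real (Suc k)" by simp
  ultimately show ?thesis by (rule exI[of _ "real (Suc k)", OF conjI, rotated])
qed

section \<open>Small exceptional sets and a bound for single coefficients\<close>

lemma exists_outside_small_set:
  fixes S :: "real set"
  assumes "S \<in> lmeasurable" "measure lebesgue S < v - u"
  shows "\<exists>t\<in>{u..v}. t \<notin> S"
proof (rule ccontr)
  assume "\<not> ?thesis"
  then have "{u..v} \<subseteq> S" by auto
  then have "measure lebesgue {u..v} \<le> measure lebesgue S"
    using assms(1) by (intro measure_mono_fmeasurable) auto
  moreover have "u \<le> v" using assms(2) measure_nonneg[of lebesgue S] by linarith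
  ultimately show False using assms(2) by simp
qed

lemma lmeasurable_shift:
  fixes S :: "real set"
  assumes "S \<in> lmeasurable"
  shows "{t. t + s \<in> S} \<in> lmeasurable" "measure lebesgue {t. t + s \<in> S} = measure lebesgue S"
proof -
  have "{t. t + s \<in> S} = (+) (- s) ` S" by (auto simp: image_iff intro!: bexI[of _ "_ + s"])
  then show "{t. t + s \<in> S} \<in> lmeasurable" "measure lebesgue {t. t + s \<in> S} = measure lebesgue S"
    by (simp_all only: measurable_translation[OF assms] measure_translation)
qed

text \<open>Differences of consecutive partial sums bound \<open>u + v\<close>, the two terms of
  frequency \<open>k\<close> at \<open>t\<close>. A quarter-period shift replaces this by
  \<open>\<i> * (u - v)\<close>, and the two bounds together isolate \<open>v\<close>.\<close>

lemma coefficient_le_maximal_function: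
  assumes D: "D \<in> lmeasurable" "measure lebesgue D < 1"
    and bound: "\<And>t n. t \<in> {0..9} - D \<Longrightarrow> cmod (trig_sum a b n t) \<le> K" and "k > 0"
  shows "cmod (b k) \<le> 2 * K"
proof -
  \<comment> \<open>A quarter of the period of frequency \<open>k\<close>. It is at most 2, so
    \<open>t\<close> in \<open>[0, 7]\<close> leaves the shifted point in
    \<open>[0, 9]\<close>.\<close>
  let ?s = "pi / (2 * k)"
  have "measure lebesgue (D \<union> {t. t + ?s \<in> D}) \<le> measure lebesgue D + measure lebesgue {t. t + ?s \<in> D}"
    using D(1) lmeasurable_shift[OF D(1)] by (intro measure_Un_le) (auto simp: fmeasurableD)
  then have "measure lebesgue (D \<union> {t. t + ?s \<in> D}) < 7 - 0"
    using D lmeasurable_shift[OF D(1), of ?s] by simp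
  moreover have "D \<union> {t. t + ?s \<in> D} \<in> lmeasurable"
    using D(1) lmeasurable_shift[OF D(1)] by (intro fmeasurable.Un) auto
  ultimately obtain t where t: "t \<in> {0..7}" "t \<notin> D" "t + ?s \<notin> D"
    using exists_outside_small_set[of _ 7 0] by blast
  have s: "0 \<le> ?s" "?s \<le> 2"
    using \<open>k > 0\<close> pi_less_4 by (auto simp: divide_simps intro: order_trans[of _ 4])
  have diff: "cmod (a k * cis (k * x) + b k * cis (- (k * x))) \<le> 2 * K" if "x \<in> {0..9} - D" for x :: real
  proof -
    have "a k * cis (k * x) + b k * cis (- (k * x)) = trig_sum a b k x - trig_sum a b (k - 1) x"
      using \<open>k > 0\<close> by (cases k) (simp_all add: trig_sum_def del: of_nat_Suc)
    also have "cmod \<dots> \<le> K + K"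
      by (rule order_trans[OF norm_triangle_ineq4 add_mono]) (rule bound, fact that)+
    finally show ?thesis by simp
  qed
  define u where "u = a k * cis (k * t)"
  define v where "v = b k * cis (- (k * t))"
  have 1: "cmod (u + v) \<le> 2 * K" unfolding u_def v_def using t by (intro diff) auto
  have "k * (t + ?s) = k * t + pi / 2" using \<open>k > 0\<close> by (simp add: field_simps)
  then have "a k * cis (k * (t + ?s)) + b k * cis (- (k * (t + ?s))) = \<i> * (u - v)"
    by (simp only: minus_add_distrib cis_mult[symmetric] u_def v_def) (simp add: cis_pi_half algebra_simps cis_minus_pi_half)
  moreover have "t + ?s \<in> {0..9} - D" using t s by auto
  ultimately have 2: "cmod (u - v) \<le> 2 * K" using diff[of "t + ?s"] by (simp add: norm_mult)
  have "cmod ((u + v) - (u - v)) \<le> 2 * K + 2 * K"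
    by (rule order_trans[OF norm_triangle_ineq4 add_mono[OF 1 2]])
  moreover have "(u + v) - (u - v) = 2 * v" by simp
  ultimately show ?thesis by (simp add: norm_mult v_def)
qed

lemma sum_symmetric_interval:
  "(\<Sum>n\<in>{- int N..int N}. h n) = (\<Sum>k\<le>N. h (int k) + (if k = 0 then 0 else h (- int k)))"
  for h :: "int \<Rightarrow> 'a::comm_monoid_add"
proof (induction N)
  case (Suc N)
  have "{- int (Suc N)..int (Suc N)} = insert (int (Suc N)) (insert (- int (Suc N)) {- int N..int N})"
    by auto
  then show ?case by (simp add: Suc add_ac)
qed simp

subsection \<open>The function without representation\<close>

text \<open>The amplitudes decrease so fast that all later ones are negligible against \<open>amp i ^ 3\<close>.\<close>

definition amp :: "nat \<Rightarrow> real" where "amp i = (1 / 2) ^ (4 ^ i)"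

definition witness :: "(nat \<Rightarrow> nat) \<Rightarrow> real \<Rightarrow> complex" where
  "witness m t = (\<Sum>i. of_real (amp i) * cis (- (real (m i) * t)))"

lemma amp_pos: "amp i > 0" by (simp add: amp_def)

lemma amp_le: "amp i \<le> (1 / 2) ^ Suc i"
proof -
  have "Suc i \<le> 4 ^ i" by (induction i) auto
  then show ?thesis unfolding amp_def by (intro power_decreasing) auto
qed

lemma amp_le_half: "amp i \<le> 1 / 2"
  using amp_le[of i] power_decreasing[of 1 "Suc i" "1 / 2 :: real"] by simp

text \<open>The exponents satisfy \<open>3 * 4 ^ i + l \<le> 4 ^ l\<close> for \<open>l > i\<close>.
  The extra factor \<open>(1 / 2) ^ l\<close> makes the sum over all later terms of order
  \<open>amp i ^ 3\<close>.\<close>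

lemma amp_later:
  assumes "i < l" shows "amp l \<le> amp i ^ 3 * (1 / 2) ^ l"
proof -
  have "4 ^ i * 3 + l \<le> 4 ^ l"
    using Suc_leI[OF assms]
  proof (induction l rule: dec_induct)
    case base
    have "Suc i \<le> 4 ^ i" by (induction i) auto
    then show ?case by simp
  next
    case (step l)
    then show ?case by simp
  qed
  then have "(1 / 2 :: real) ^ (4 ^ l) \<le> (1 / 2) ^ (4 ^ i * 3 + l)"
    by (intro power_decreasing) auto
  then show ?thesis by (simp add: amp_def power_add power_mult)
qed

lemma amp_tendsto_0: "amp \<longlonglongrightarrow> 0"
proof (rule tendsto_sandwich[OF _ _ tendsto_const])
  show "(\<lambda>i. (1 / 2 :: real) ^ Suc i) \<longlonglongrightarrow> 0" by (intro LIMSEQ_Suc LIMSEQ_realpow_zero) auto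
  show "eventually (\<lambda>i. amp i \<le> (1 / 2) ^ Suc i) sequentially"
    by (intro always_eventually allI amp_le)
qed (auto intro: always_eventually less_imp_le amp_pos)

lemma summable_amp: "summable amp"
  by (rule summable_comparison_test'[of "\<lambda>i. (1 / 2) ^ Suc i" 0])
     (use amp_le amp_pos in \<open>auto simp: summable_geometric less_imp_le simp del: power_Suc intro!: summable_Suc_iff[THEN iffD2]\<close>)

lemma summable_witness: "summable (\<lambda>i. of_real (amp i) * cis (- (real (m i) * t)))"
  by (rule summable_comparison_test'[OF summable_amp, of 0])
     (use amp_pos in \<open>auto simp: norm_mult less_imp_le\<close>)

lemma continuous_witness: "continuous_on UNIV (witness m)"
proof (rule uniform_limit_theorem)
  show "uniform_limit UNIV (\<lambda>n t. \<Sum>i<n. of_real (amp i) * cis (- (real (m i) * t))) (witness m) sequentially"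
    unfolding witness_def[abs_def]
    by (rule Weierstrass_m_test[OF _ summable_amp]) (use amp_pos in \<open>auto simp: norm_mult less_imp_le\<close>)
qed (auto intro!: always_eventually continuous_intros)

lemma cis_nat_periodic: "cis (- (real k * (t + 2 * pi))) = cis (- (real k * t))"
proof -
  have "cis (- (real k * (t + 2 * pi))) = cis (- (real k * t)) * cis (2 * pi * of_int (- int k))"
    by (simp add: cis_mult algebra_simps)
  then show ?thesis by (simp only: cis_multiple_2pi[OF Ints_of_int] mult_1_right)
qed

lemma witness_periodic: "witness m (t + 2 * pi) = witness m t"
  by (simp only: witness_def cis_nat_periodic)

text \<open>Terms before \<open>i\<close> are too slow to move under the shift and terms after
  \<open>i\<close> have negligible amplitude, so only term \<open>i\<close> remains. Each error is
  at most \<open>4 * amp i ^ 3 * (1 / 2) ^ l\<close>, whence the factor 8.\<close>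

lemma witness_increment:
  assumes \<theta>: "0 \<le> \<theta>" and before: "\<And>l. l < i \<Longrightarrow> real (m l) * \<theta> \<le> 4 * amp i ^ 3"
  shows "cmod (witness m (x + \<theta>) - witness m x -
    of_real (amp i) * (cis (- (m i * \<theta>)) - 1) * cis (- (m i * x))) \<le> 8 * amp i ^ 3"
proof -
  define T where "T l = of_real (amp l) * (cis (- (m l * \<theta>)) - 1) * cis (- (m l * x))" for l
  have T_eq: "T l = of_real (amp l) * cis (- (real (m l) * (x + \<theta>))) - of_real (amp l) * cis (- (real (m l) * x))" for l
    by (simp add: T_def cis_mult algebra_simps flip: distrib_left)
  have "T sums (witness m (x + \<theta>) - witness m x)"
    unfolding witness_def T_eq[abs_def] by (intro sums_diff summable_sums summable_witness)
  then have sums: "(\<lambda>l. T l - (if l = i then T l else 0)) sums (witness m (x + \<theta>) - witness m x - T i)"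
    by (intro sums_diff sums_single)
  have le: "cmod (T l - (if l = i then T l else 0)) \<le> 4 * amp i ^ 3 * (1 / 2) ^ l" for l
  proof -
    have T: "cmod (T l) = amp l * cmod (cis (- (m l * \<theta>)) - 1)"
      using amp_pos[of l] by (simp add: T_def norm_mult)
    consider "l < i" | "l = i" | "i < l" by linarith
    then show ?thesis
    proof cases
      case 1
      have "cmod (cis (- (m l * \<theta>)) - 1) \<le> 4 * amp i ^ 3"
        using cmod_cis_minus_1_le[of "- (m l * \<theta>)"] before[OF 1] \<theta> by simp
      moreover have "amp l \<le> (1 / 2) ^ l"
        using amp_le[of l] by (simp add: field_simps)
      ultimately have "cmod (T l) \<le> (1 / 2) ^ l * (4 * amp i ^ 3)"
        unfolding T using amp_pos by (intro mult_mono) (auto simp: less_imp_le)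
      then show ?thesis using 1 by (simp add: mult.commute)
    next
      case 3
      have "cmod (cis (- (m l * \<theta>)) - 1) \<le> 2"
        using norm_triangle_ineq4[of "cis (- (m l * \<theta>))" 1] by simp
      then have "cmod (T l) \<le> amp i ^ 3 * (1 / 2) ^ l * 2"
        unfolding T using amp_pos[of l] amp_later[OF 3] by (intro mult_mono) (auto simp: less_imp_le)
      moreover have "0 \<le> amp i ^ 3 * (1 / 2) ^ l" using amp_pos[of i] by simp
      ultimately show ?thesis using 3 by simp
    qed (use amp_pos in \<open>simp add: less_imp_le\<close>)
  qed
  have geom: "(\<lambda>l. 4 * amp i ^ 3 * (1 / 2) ^ l) sums (4 * amp i ^ 3 * 2)"
    using geometric_sums[of "1 / 2 :: real"] by (intro sums_mult) simp
  have "cmod (\<Sum>l. T l - (if l = i then T l else 0)) \<le> 4 * amp i ^ 3 * 2"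
    using norm_suminf_le[OF le sums_summable[OF geom]] by (simp only: sums_unique[OF geom, symmetric])
  then show ?thesis using sums by (simp add: sums_iff T_def)
qed

section \<open>Choice of the stage and contradiction\<close>

lemma trig_sum_periodic: "trig_sum a b n (t + 2 * pi) = trig_sum a b n t"
proof -
  have "cis (real k * (t + 2 * pi)) = cis (real k * t)" for k
    using arg_cong[OF cis_nat_periodic[of k t], of cnj] by (simp only: cis_cnj minus_minus)
  then show ?thesis by (simp only: trig_sum_def cis_nat_periodic)
qed

lemma continuous_trig_sum: "continuous_on S (trig_sum a b n)"
  unfolding trig_sum_def[abs_def] by (intro continuous_intros)

text \<open>The factor 5 covers the distance from a curve point with \<open>mu t \<le> 4 * g\<close>
  to the nearest good point on the circle, at most \<open>g / 2 + 4 * g\<close>.\<close>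

lemma uniform_modulus:
  fixes F :: "complex \<Rightarrow> complex"
  assumes "continuous_on (cball 0 1) F" "r > 0"
  obtains g where "g > 0"
    "\<And>z w. cmod z \<le> 1 \<Longrightarrow> cmod w \<le> 1 \<Longrightarrow> cmod (z - w) \<le> 5 * g \<Longrightarrow> cmod (F z - F w) \<le> r"
proof -
  have "uniformly_continuous_on (cball 0 1) F"
    using assms(1) by (rule compact_uniformly_continuous) simp
  then obtain \<eta> where \<eta>: "\<eta> > 0"
    "\<And>z w. z \<in> cball 0 1 \<Longrightarrow> w \<in> cball 0 1 \<Longrightarrow> dist w z < \<eta> \<Longrightarrow> dist (F w) (F z) < r"
    using \<open>r > 0\<close> unfolding uniformly_continuous_on_def by metis
  show thesis
  proof
    show "\<eta> / 10 > 0" using \<eta>(1) by simp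
    show "cmod (F z - F w) \<le> r" if "cmod z \<le> 1" "cmod w \<le> 1" "cmod (z - w) \<le> 5 * (\<eta> / 10)" for z w
      using \<eta>(2)[of w z] \<eta>(1) that by (simp add: dist_norm)
  qed
qed

text \<open>The frequency \<open>m i = p (n i) / amp i ^ 3\<close> is also at most
  \<open>amp i ^ 3 * p (n i + 1)\<close>, hence far from both neighbours. The choices are made in
  the order \<open>K\<close>, \<open>i\<close>, \<open>M\<close> and \<open>J\<close>, \<theta>,
  \<open>g\<close>, \<open>A\<close>, each depending only on earlier ones.\<close>

lemma no_representation:
  fixes p n m :: "nat \<Rightarrow> nat" and a b :: "nat \<Rightarrow> complex" and j0 :: nat
  assumes lac: "\<And>j. j0 \<le> j \<Longrightarrow> 4 * p j \<le> p (Suc j)" and p_pos: "\<And>j. p j > 0" and p_mono: "strict_mono p"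
    and b_off: "\<And>k. k \<notin> range p \<Longrightarrow> b k = 0"
    and n_ge: "\<And>i. j0 \<le> n i" and n_mono: "strict_mono n"
    and n_grow: "\<And>i j. n i \<le> j \<Longrightarrow> real (p j) \<le> amp i ^ 6 * real (p (Suc j))"
    and m: "\<And>i. real (m i) * amp i ^ 3 = real (p (n i))"
    and null: "negligible {t\<in>{0..9}. \<not> (\<lambda>N. trig_sum a b N t) \<longlonglongrightarrow> witness m t}"
  shows False
proof -
  let ?S = "trig_sum a b" and ?f = "witness m"
  have "negligible {t\<in>{0..9}. \<not> convergent (\<lambda>N. ?S N t)}"
    by (rule negligible_subset[OF null]) (auto simp: convergent_def)
  then have "\<exists>K\<ge>1. measure lebesgue {t\<in>{0..9}. \<exists>n. K < cmod (?S n t)} < 1 / 50"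
    by (rule maximal_function_bounded[OF continuous_trig_sum]) simp
  then obtain K where K: "K \<ge> 1" "measure lebesgue {t\<in>{0..9}. \<exists>n. K < cmod (?S n t)} < 1 / 50" by blast
  define D where "D = {t\<in>{0..9}. \<exists>n. K < cmod (?S n t)}"
  have D_eq: "D = {t\<in>{0..9}. \<exists>n\<ge>0. K < cmod (?S n t)}"
    by (simp only: D_def le0 simp_thms)
  have D: "D \<in> lmeasurable" "measure lebesgue D < 1 / 50"
    unfolding D_eq by (rule lmeasurable_exceed[OF continuous_trig_sum]) (use K(2) in \<open>simp only: le0 simp_thms\<close>)
  have b_le: "cmod (b k) \<le> 2 * K" for k
  proof (cases "k = 0")
    case True
    have "0 \<notin> range p" using p_pos by (metis less_irrefl imageE)
    then show ?thesis using b_off[of 0] K(1) True by simp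
  next
    case False
    then show ?thesis using D
      by (intro coefficient_le_maximal_function[of D a b K]) (auto simp: D_def not_less)
  qed
  define C1 where "C1 = nontangential_const j0"
  define C2 where "C2 = coefficient_const j0"
  \<comment> \<open>\<open>B1 * \<alpha> ^ 3\<close> collects the error terms of the main estimate
    and \<open>B0 * x ^ 2\<close> the contribution of the bad part; \<open>y\<close> is small enough
    that \<open>B0 * y \<le> 1\<close>.\<close>
  define B1 where "B1 = 5 / 4 * (2 * pi * (30 + 8 * K * (j0 + 2)) + 2 * pi\<^sup>2 * K * (1 + C2))"
  define B0 where "B0 = 5 / 4 * (2 * pi * (2 * C1 * K + 2) + 10 * (2 * C1 * K)\<^sup>2)"
  define y where "y = 1 / (1 + B0)"
  have C1_pos: "C1 > 0" by (simp add: C1_def nontangential_const_def)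
  have B0_pos: "B0 > 0" using C1_pos K(1) by (auto simp: B0_def intro!: add_pos_nonneg mult_pos_pos)
  have y: "0 < y" "y \<le> 1" "B0 * y \<le> 1" using B0_pos by (auto simp: y_def field_simps)
  \<comment> \<open>\<open>B1\<close> and \<open>y\<close> depend only on \<open>K\<close> and
    \<open>j0\<close>, so a late enough stage can be selected after them.\<close>
  have "eventually (\<lambda>i. B1 * amp i < y) sequentially"
    using tendsto_mult_left[OF amp_tendsto_0, of B1] y(1) by (intro order_tendstoD) auto
  then obtain i where i: "B1 * amp i < y" by (auto simp: eventually_sequentially)
  define \<alpha> where "\<alpha> = amp i"
  have \<alpha>: "0 < \<alpha>" "\<alpha> \<le> 1 / 2" unfolding \<alpha>_def by (rule amp_pos, rule amp_le_half)
  have \<alpha>3: "0 < \<alpha> ^ 3" "\<alpha> ^ 3 \<le> 1 / 8"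
    using \<alpha> power_mono[of \<alpha> "1 / 2" 3] by (auto simp: power_divide)
  have null_diff: "negligible {t\<in>{0..9}. \<not> (\<lambda>N. ?S N t - ?f t) \<longlonglongrightarrow> 0}"
    using null by (simp add: LIM_zero_iff)
  have cont_diff: "continuous_on UNIV (\<lambda>t. ?S N t - ?f t)" for N
    by (intro continuous_intros continuous_trig_sum continuous_witness)
  have "\<exists>M. measure lebesgue {t\<in>{0..9}. \<exists>N\<ge>M. \<alpha> ^ 3 < cmod (?S N t - ?f t)} < 1 / 50"
    by (rule convergence_in_measure[OF cont_diff null_diff \<alpha>3(1)]) simp
  then obtain M where M: "measure lebesgue {t\<in>{0..9}. \<exists>N\<ge>M. \<alpha> ^ 3 < cmod (?S N t - ?f t)} < 1 / 50" ..
  define E where "E = {t\<in>{0..9}. \<exists>N\<ge>M. \<alpha> ^ 3 < cmod (?S N t - ?f t)}"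
  have E: "E \<in> lmeasurable" "measure lebesgue E < 1 / 50"
    unfolding E_def by (rule lmeasurable_exceed[OF cont_diff], rule M)
  \<comment> \<open>Large enough for the partial sum of order \<open>p J\<close> to be past
    \<open>M\<close> and to reach beyond the gap that contains \<open>m i\<close>.\<close>
  define J where "J = max M (Suc (n i))"
  define N where "N = p J"
  have "M \<le> N" using strict_mono_imp_increasing[OF p_mono, of J] by (simp add: N_def J_def)
  have "n i < J" by (simp add: J_def)
  have m_pos: "real (m i) > 0" using m[of i] p_pos[of "n i"] by (metis of_nat_0_less_iff mult_zero_left neq0_conv of_nat_0)
  have m\<alpha>: "real (m i) * \<alpha> ^ 3 = real (p (n i))" using m[of i] by (simp add: \<alpha>_def)

  \<comment> \<open>The chain for the shift: the frequency \<open>m i\<close> to be flipped,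
    followed by the frequencies above it, which are to be nearly fixed.\<close>
  define P where "P s = (if s = 0 then real (m i) else real (p (n i + s)))" for s
  have P_pos: "P s > 0" for s using m_pos p_pos by (simp add: P_def)
  have grow3: "1 / \<alpha> ^ 3 * x \<le> z" if "x * \<alpha> ^ 3 \<le> \<alpha> ^ 6 * z" for x z
  proof -
    have "\<alpha> ^ 3 * x \<le> \<alpha> ^ 3 * (\<alpha> ^ 3 * z)" using that by (simp add: mult_ac flip: power_add)
    then have "x \<le> \<alpha> ^ 3 * z" by (simp only: mult_le_cancel_left_pos[OF \<alpha>3(1)])
    then show ?thesis using \<alpha>3(1) by (simp add: field_simps)
  qed
  have P_grow: "1 / \<alpha> ^ 3 * P s \<le> P (Suc s)" for s
  proof (rule grow3)
    have step: "real (p (n i + s)) \<le> \<alpha> ^ 6 * real (p (Suc (n i + s)))"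
      unfolding \<alpha>_def by (rule n_grow) simp
    show "P s * \<alpha> ^ 3 \<le> \<alpha> ^ 6 * P (Suc s)"
    proof (cases "s = 0")
      case True
      then show ?thesis using step by (simp add: P_def m\<alpha>)
    next
      case False
      have "real (p (n i + s)) * \<alpha> ^ 3 \<le> real (p (n i + s)) * 1"
        using \<alpha>3 by (intro mult_left_mono) auto
      then show ?thesis using step False by (simp add: P_def)
    qed
  qed
  have H: "1 / \<alpha> ^ 3 \<ge> 2" using \<alpha>3 by (simp add: field_simps)
  have H': "2 * pi / (1 / \<alpha> ^ 3) = 2 * pi * \<alpha> ^ 3" by simp
  obtain \<theta> where \<theta>0: "\<bar>\<theta> - pi / P 0\<bar> \<le> 2 * pi * \<alpha> ^ 3 * (1 / P 0 - 1 / P (J - n i))"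
    and \<theta>1: "cmod (cis (P 0 * \<theta>) + 1) \<le> 2 * pi * \<alpha> ^ 3 * (1 - P 0 / P (J - n i))"
    and \<theta>2: "\<And>r. r \<in> {1..J - n i} \<Longrightarrow> cmod (cis (P r * \<theta>) - 1) \<le> 2 * pi * \<alpha> ^ 3 * (1 - P r / P (J - n i))"
    using simultaneous_shift[of P "1 / \<alpha> ^ 3" "J - n i", OF P_pos H P_grow] unfolding H' by blast
  have le1: "2 * pi * \<alpha> ^ 3 * (1 - P r / P s) \<le> 2 * pi * \<alpha> ^ 3" for r s
    using P_pos[of r] P_pos[of s] \<alpha>3 by (intro mult_left_le) auto
  have \<theta>_near: "\<bar>\<theta> - pi / m i\<bar> \<le> (pi / 4) / m i"
  proof -
    have "\<bar>\<theta> - pi / m i\<bar> \<le> 2 * pi * \<alpha> ^ 3 * (1 / m i - 1 / P (J - n i))"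
      using \<theta>0 by (simp add: P_def)
    also have "\<dots> \<le> 2 * pi * \<alpha> ^ 3 * (1 / m i)"
      using P_pos[of "J - n i"] \<alpha>3 by (intro mult_left_mono) auto
    also have "\<dots> \<le> 2 * pi * (1 / 8) * (1 / m i)"
      using \<alpha>3 by (intro mult_right_mono mult_left_mono) auto
    finally show ?thesis by simp
  qed
  have \<theta>_pos: "0 \<le> \<theta>"
  proof -
    have "(pi / 4) / m i \<le> pi / m i" using m_pos by (intro divide_right_mono) auto
    then show ?thesis using \<theta>_near by linarith
  qed
  have \<theta>_le: "\<theta> \<le> 4 / m i"
  proof -
    have "\<theta> \<le> pi / m i + (pi / 4) / m i" using \<theta>_near by linarith
    also have "\<dots> = (5 / 4 * pi) / m i" by (simp add: add_divide_distrib[symmetric])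
    also have "\<dots> \<le> 4 / m i"
      using m_pos pi_approx by (intro divide_right_mono) auto
    finally show ?thesis .
  qed
  have m\<theta>: "real (m i) * \<theta> \<le> 4" using \<theta>_le m_pos by (simp add: field_simps)
  \<comment> \<open>Frequencies up to \<open>p (n i)\<close> are smaller than \<open>m i\<close> by
    the factor \<open>\<alpha> ^ 3\<close>, so a shift of order \<open>1 / m i\<close> hardly turns
    them.\<close>
  have p\<theta>: "real (p (n i)) * \<theta> \<le> 4 * \<alpha> ^ 3"
  proof -
    have "real (p (n i)) * \<theta> = (real (m i) * \<theta>) * \<alpha> ^ 3" by (simp flip: m\<alpha>)
    also have "\<dots> \<le> 4 * \<alpha> ^ 3" using m\<theta> \<alpha>3 by (intro mult_right_mono) auto
    finally show ?thesis .
  qed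
  have "\<theta> \<le> 1"
  proof -
    have "real (p (n i)) \<ge> 1" using p_pos[of "n i"] by simp
    then have "1 * \<theta> \<le> real (p (n i)) * \<theta>" using \<theta>_pos by (intro mult_right_mono) auto
    then show ?thesis using p\<theta> \<alpha>3 by linarith
  qed
  \<comment> \<open>The relative increment of the term of frequency \<open>m i\<close>. It is near
    -2, but the bounds 1 and 2 on its modulus suffice.\<close>
  define \<kappa> where "\<kappa> = cis (- (m i * \<theta>)) - 1"
  have \<kappa>: "1 \<le> cmod \<kappa>" "cmod \<kappa> \<le> 2"
  proof -
    have "cmod (cis (m i * \<theta>) + 1) \<le> 2 * pi * \<alpha> ^ 3"
      using order_trans[OF \<theta>1 le1[of 0 "J - n i"]] by (simp add: P_def)
    also have "\<dots> \<le> 2 * pi * (1 / 8)" using \<alpha>3 by (intro mult_left_mono) auto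
    also have "\<dots> \<le> 1" using pi_less_4 by simp
    finally have "cmod (cis (m i * \<theta>) + 1) \<le> 1" .
    moreover have "cmod (2 :: complex) \<le> cmod (cis (m i * \<theta>) + 1) + cmod (cis (m i * \<theta>) - 1)"
      using norm_triangle_ineq4[of "cis (m i * \<theta>) + 1" "cis (m i * \<theta>) - 1"] by simp
    ultimately show "1 \<le> cmod \<kappa>" by (simp add: \<kappa>_def cmod_cis_uminus_minus_1)
    show "cmod \<kappa> \<le> 2"
      using norm_triangle_ineq4[of "cis (- (m i * \<theta>))" 1] by (simp add: \<kappa>_def)
  qed

  \<comment> \<open>The good points. Only finitely many continuous conditions at a fixed
    \<open>N\<close> are imposed, so this set is closed.\<close>
  define \<Gamma> where "\<Gamma> = {t. (\<forall>k. k \<le> N \<longrightarrow> cmod (?S k t) \<le> K) \<and> (\<forall>k. k \<le> N \<longrightarrow> cmod (?S k (t + \<theta>)) \<le> K) \<and>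
     cmod (?S N t - ?f t) \<le> \<alpha> ^ 3 \<and> cmod (?S N (t + \<theta>) - ?f (t + \<theta>)) \<le> \<alpha> ^ 3}"
  \<comment> \<open>Four exceptional sets of measure below 1/50 each, hence below 2/25, the constant
    to which the damping function is tuned.\<close>
  define U where "U = D \<union> {t. t + \<theta> \<in> D} \<union> (E \<union> {t. t + \<theta> \<in> E})"
  have U: "U \<in> lmeasurable" "measure lebesgue U < 2 / 25"
  proof -
    note Ds = lmeasurable_shift[OF D(1), of \<theta>] and Es = lmeasurable_shift[OF E(1), of \<theta>]
    show "U \<in> lmeasurable" unfolding U_def using D(1) E(1) Ds(1) Es(1) by (intro fmeasurable.Un)
    have "measure lebesgue U \<le> measure lebesgue (D \<union> {t. t + \<theta> \<in> D}) + measure lebesgue (E \<union> {t. t + \<theta> \<in> E})"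
      unfolding U_def using D(1) E(1) Ds(1) Es(1) by (intro measure_Un_le fmeasurableD fmeasurable.Un)
    also have "\<dots> \<le> (measure lebesgue D + measure lebesgue {t. t + \<theta> \<in> D}) + (measure lebesgue E + measure lebesgue {t. t + \<theta> \<in> E})"
      using D(1) E(1) Ds(1) Es(1) by (intro add_mono measure_Un_le fmeasurableD)
    also have "\<dots> < 2 / 25" unfolding Ds(2) Es(2) using D(2) E(2) by simp
    finally show "measure lebesgue U < 2 / 25" .
  qed
  have good: "t \<in> \<Gamma>" if t: "t \<in> {0..8}" "t \<notin> U" for t
  proof -
    have t': "t \<in> {0..9}" "t + \<theta> \<in> {0..9}" using t(1) \<theta>_pos \<open>\<theta> \<le> 1\<close> by auto
    have S: "cmod (?S k s) \<le> K" if "s \<in> {0..9}" "s \<notin> D" for s k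
      using that unfolding D_def by (auto simp: not_less)
    have F: "cmod (?S N s - ?f s) \<le> \<alpha> ^ 3" if "s \<in> {0..9}" "s \<notin> E" for s
      using that \<open>M \<le> N\<close> unfolding E_def by (auto simp: not_less)
    show ?thesis unfolding \<Gamma>_def using S F t' t(2) by (auto simp: U_def)
  qed
  have "closed \<Gamma>" unfolding \<Gamma>_def
    by (intro closed_Collect_conj closed_Collect_all closed_Collect_imp open_Collect_const closed_Collect_le
        continuous_on_norm continuous_on_diff continuous_on_const
        continuous_on_compose2[OF continuous_trig_sum[of UNIV]] continuous_on_compose2[OF continuous_witness]
        continuous_on_add continuous_on_id continuous_trig_sum continuous_witness subset_UNIV)
  \<comment> \<open>The period starts and, by periodicity, ends at a good point. With
    \<open>t0 \<le> 1\<close> and \<open>\<theta> \<le> 1\<close>, the period and its shift stay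
    within \<open>[0, 9]\<close>.\<close>
  obtain t0 where t0: "t0 \<in> {0..1}" "t0 \<notin> U"
    using exists_outside_small_set[OF U(1), of 1 0] U(2) by auto
  then have t0\<Gamma>: "t0 \<in> \<Gamma>" by (intro good) auto
  have "(t0 + 2 * pi) + \<theta> = (t0 + \<theta>) + 2 * pi" by simp
  then have t1\<Gamma>: "t0 + 2 * pi \<in> \<Gamma>"
    using t0\<Gamma> unfolding \<Gamma>_def mem_Collect_eq by (simp only: trig_sum_periodic witness_periodic) simp

  define d where "d j = b (p j)" for j
  define e where "e = 10 * \<alpha> ^ 3"
  define e1 where "e1 = 8 * K * (j0 + 2) * \<alpha> ^ 3"
  have e_pos: "e > 0" using \<alpha>3 by (simp add: e_def)
  have "continuous_on (cball 0 1) (\<lambda>z. coanalytic_part d p J z)"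
    by (intro continuous_intros)
  then obtain g1 where g1: "g1 > 0" "\<And>z w. cmod z \<le> 1 \<Longrightarrow> cmod w \<le> 1 \<Longrightarrow> cmod (z - w) \<le> 5 * g1 \<Longrightarrow>
      cmod (coanalytic_part d p J z - coanalytic_part d p J w) \<le> 1"
    using uniform_modulus[OF _ zero_less_one] by blast
  have "continuous_on (cball 0 1) (\<lambda>z. coanalytic_part (shift_coeff d p \<theta>) p J z)"
    by (intro continuous_intros)
  then obtain g2 where g2: "g2 > 0" "\<And>z w. cmod z \<le> 1 \<Longrightarrow> cmod w \<le> 1 \<Longrightarrow> cmod (z - w) \<le> 5 * g2 \<Longrightarrow>
      cmod (coanalytic_part (shift_coeff d p \<theta>) p J z - coanalytic_part (shift_coeff d p \<theta>) p J w) \<le> e"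
    using uniform_modulus[OF _ e_pos] by blast
  have "continuous_on (cball 0 1) (\<lambda>z. z ^ m i * (analytic_part a (p J) (z * cis \<theta>) - analytic_part a (p J) z))"
    by (intro continuous_intros)
  then obtain g3 where g3: "g3 > 0" "\<And>z w. cmod z \<le> 1 \<Longrightarrow> cmod w \<le> 1 \<Longrightarrow> cmod (z - w) \<le> 5 * g3 \<Longrightarrow>
      cmod (z ^ m i * (analytic_part a (p J) (z * cis \<theta>) - analytic_part a (p J) z) -
            w ^ m i * (analytic_part a (p J) (w * cis \<theta>) - analytic_part a (p J) w)) \<le> e"
    using uniform_modulus[OF _ e_pos] by blast
  define g where "g = min g1 (min g2 g3)"
  have g: "g > 0" "g \<le> g1" "g \<le> g2" "g \<le> g3" using g1(1) g2(1) g3(1) by (auto simp: g_def)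

  \<comment> \<open>A finite \<open>g\<close>-net of good points. Any point of the period outside
    \<open>U\<close> is within \<open>g\<close> of it, so the cutoff vanishes there and its integral
    is at most the measure of \<open>U\<close>.\<close>
  have "compact (\<Gamma> \<inter> {t0..t0 + 2 * pi})" using \<open>closed \<Gamma>\<close> by (intro closed_Int_compact) auto
  from seq_compact_imp_totally_bounded[OF compact_imp_seq_compact[OF this], rule_format, OF g(1)]
  obtain F where F: "finite F" "F \<subseteq> \<Gamma> \<inter> {t0..t0 + 2 * pi}" "\<Gamma> \<inter> {t0..t0 + 2 * pi} \<subseteq> (\<Union>x\<in>F. ball x g)"
    by (elim exE conjE)
  define A where "A = insert t0 (insert (t0 + 2 * pi) F)"
  have A\<Gamma>: "A \<subseteq> \<Gamma>" using F t0\<Gamma> t1\<Gamma> by (auto simp: A_def)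
  interpret T: tent_curve t0 A
    by unfold_locales (use F in \<open>auto simp: A_def\<close>)
  have cutoff_small: "integral {t0..t0 + 2 * pi} (T.cutoff g) \<le> 2 / 25"
  proof -
    have U_int: "((indicator U :: real \<Rightarrow> real) has_integral measure lebesgue U) UNIV"
      using U(1) lmeasurable_iff_has_integral by blast
    have "integral {t0..t0 + 2 * pi} (T.cutoff g) \<le> integral UNIV (indicator U :: real \<Rightarrow> real)"
    proof (rule order_trans[OF integral_le integral_subset_le])
      show "T.cutoff g integrable_on {t0..t0 + 2 * pi}"
        by (intro integrable_continuous_real T.continuous_cutoff g)
      show "(indicator U :: real \<Rightarrow> real) integrable_on {t0..t0 + 2 * pi}"
        using U_int by (intro integrable_on_subinterval[of _ UNIV]) auto
      then show "(indicator U :: real \<Rightarrow> real) integrable_on {t0..t0 + 2 * pi}" .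
      show "T.cutoff g t \<le> indicator U t" if t: "t \<in> {t0..t0 + 2 * pi}" for t
      proof (cases "t \<in> U")
        case True
        then show ?thesis using T.cutoff_bounds by simp
      next
        case False
        have "t \<in> {0..8}" using t t0 pi_approx by auto
        with good[OF this False] t F(3) obtain x where "x \<in> F" "t \<in> ball x g" by blast
        then have "T.mu t \<le> g" using T.mu_le[of x t] by (auto simp: A_def dist_real_def)
        then show ?thesis using T.cutoff_eq_0[OF g(1)] by simp
      qed
    qed (use U_int in auto)
    also have "\<dots> = measure lebesgue U" using U_int by (rule integral_unique)
    finally show ?thesis using U(2) by simp
  qed

  interpret L: lacunary_stage t0 A a b d p j0 J "n i" "m i" \<theta> K g e e1 "2 * pi * \<alpha> ^ 3" "of_real \<alpha> * \<kappa>"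
  proof
    show "4 * p j \<le> p (Suc j)" if "j0 \<le> j" for j using that by (rule lac)
    show "p j > 0" for j by (rule p_pos)
    show "strict_mono p" by (rule p_mono)
    show "b (p j) = d j" for j by (simp add: d_def)
    show "b k = 0" if "k \<notin> range p" for k using that by (rule b_off)
    show "1 \<le> K" by (rule K)
    show "cmod (d j) \<le> 2 * K" for j unfolding d_def by (rule b_le)
    show "cmod (?S k x) \<le> K" if "x \<in> A" "k \<le> p J" for x k
      using that A\<Gamma> by (auto simp: \<Gamma>_def N_def)
    show "cmod (?S k (x + \<theta>)) \<le> K" if "x \<in> A" "k \<le> p J" for x k
      using that A\<Gamma> by (auto simp: \<Gamma>_def N_def)
    \<comment> \<open>The constant 10 in \<open>e\<close>: one \<open>\<alpha> ^ 3\<close> at each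
      of the two points for replacing the partial sum by the function, and 8 for the increment of
      the function itself.\<close>
    show "cmod (?S (p J) (x + \<theta>) - ?S (p J) x - of_real \<alpha> * \<kappa> * cis (- (m i * x))) \<le> e" if "x \<in> A" for x :: real
    proof -
      have x: "cmod (?S N x - ?f x) \<le> \<alpha> ^ 3" "cmod (?S N (x + \<theta>) - ?f (x + \<theta>)) \<le> \<alpha> ^ 3"
        using that A\<Gamma> by (auto simp: \<Gamma>_def)
      \<comment> \<open>An earlier \<open>m l\<close> lies below \<open>p (Suc (n l))\<close>, which
        is at most \<open>p (n i)\<close>, so the bound for \<open>p (n i)\<close> applies.\<close>
      have before: "real (m l) * \<theta> \<le> 4 * amp i ^ 3" if "l < i" for l
      proof -
        have "amp l ^ 3 * real (m l) \<le> amp l ^ 3 * (amp l ^ 3 * real (p (Suc (n l))))"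
          using n_grow[of l "n l"] m[of l] by (simp add: mult_ac flip: power_add)
        then have "real (m l) \<le> amp l ^ 3 * real (p (Suc (n l)))"
          by (simp only: mult_le_cancel_left_pos[OF zero_less_power[OF amp_pos]])
        also have "\<dots> \<le> 1 * real (p (n i))"
        proof (intro mult_mono)
          show "amp l ^ 3 \<le> 1" using amp_pos[of l] amp_le_half[of l] by (intro power_le_one) auto
          have "Suc (n l) \<le> n i" using that n_mono by (simp add: Suc_le_eq strict_mono_less)
          then show "real (p (Suc (n l))) \<le> real (p (n i))" using p_mono by (simp add: strict_mono_less_eq)
        qed (use amp_pos[of l] in auto)
        finally have "real (m l) * \<theta> \<le> real (p (n i)) * \<theta>" using \<theta>_pos by (intro mult_right_mono) auto
        then show ?thesis using p\<theta> by (simp add: \<alpha>_def)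
      qed
      have "?S N (x + \<theta>) - ?S N x - of_real \<alpha> * \<kappa> * cis (- (m i * x)) =
        ((?S N (x + \<theta>) - ?f (x + \<theta>)) - (?S N x - ?f x)) + (?f (x + \<theta>) - ?f x - of_real \<alpha> * \<kappa> * cis (- (m i * x)))"
        by simp
      also have "cmod \<dots> \<le> (\<alpha> ^ 3 + \<alpha> ^ 3) + 8 * \<alpha> ^ 3"
        using witness_increment[OF \<theta>_pos before, where x = x] x
        by (intro order_trans[OF norm_triangle_ineq add_mono] order_trans[OF norm_triangle_ineq4 add_mono])
           (auto simp: \<alpha>_def \<kappa>_def)
      finally show ?thesis by (simp add: e_def N_def)
    qed
    show "m i > 0" using m_pos by simp
    show "g > 0" by (rule g)
    show "0 \<le> e" using e_pos by simp
    show "0 \<le> e1" using K(1) \<alpha>3 by (simp add: e1_def)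
    show "0 < 2 * pi * \<alpha> ^ 3" using \<alpha>3 by simp
    show "integral {t0..t0 + 2 * pi} (T.cutoff g) \<le> 2 / 25" by (rule cutoff_small)
    show "j0 \<le> n i" by (rule n_ge)
    show "n i \<le> J" using \<open>n i < J\<close> by simp
    show "(\<Sum>j\<le>n i. cmod (shift_coeff d p \<theta> j)) \<le> e1"
    proof -
      have "(\<Sum>j\<le>n i. cmod (shift_coeff d p \<theta> j)) \<le> (\<Sum>j\<le>n i. 2 * K * (real (p j) * \<theta>))"
        unfolding shift_coeff_def norm_mult d_def
      proof (intro sum_mono mult_mono b_le)
        show "cmod (cis (- (p j * \<theta>)) - 1) \<le> real (p j) * \<theta>" for j
          using cmod_cis_minus_1_le[of "- (p j * \<theta>)"] \<theta>_pos by simp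
      qed (use K in auto)
      also have "\<dots> = 2 * K * \<theta> * real (\<Sum>j\<le>n i. p j)"
        by (simp add: sum_distrib_left mult_ac)
      also have "\<dots> \<le> 2 * K * \<theta> * real ((j0 + 2) * p (n i))"
        using K(1) \<theta>_pos sum_le_growth[of j0 p "n i", OF lac p_mono]
        by (intro mult_left_mono) (auto simp del: of_nat_mult of_nat_sum)
      also have "\<dots> = 2 * K * (j0 + 2) * (real (p (n i)) * \<theta>)" by (simp add: algebra_simps)
      also have "\<dots> \<le> 2 * K * (j0 + 2) * (4 * \<alpha> ^ 3)"
        using K(1) p\<theta> by (intro mult_left_mono) auto
      finally show ?thesis by (simp add: e1_def)
    qed
    show "cmod (cis (- (p j * \<theta>)) - 1) \<le> 2 * pi * \<alpha> ^ 3" if "n i < j" "j \<le> J" for j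
    proof -
      have "j - n i \<in> {1..J - n i}" "P (j - n i) = real (p j)" using that by (auto simp: P_def)
      with order_trans[OF \<theta>2[of "j - n i"] le1[of "j - n i" "J - n i"]] show ?thesis
        by (simp add: cmod_cis_uminus_minus_1)
    qed
    fix z w :: complex
    assume zw: "cmod z \<le> 1" "cmod w \<le> 1" "cmod (z - w) \<le> 5 * g"
    show "cmod (coanalytic_part d p J z - coanalytic_part d p J w) \<le> 1"
      using zw g by (intro g1(2)) auto
    show "cmod (coanalytic_part (shift_coeff d p \<theta>) p J z - coanalytic_part (shift_coeff d p \<theta>) p J w) \<le> e"
      using zw g by (intro g2(2)) auto
    show "cmod (z ^ m i * (analytic_part a (p J) (z * cis \<theta>) - analytic_part a (p J) z) -
            w ^ m i * (analytic_part a (p J) (w * cis \<theta>) - analytic_part a (p J) w)) \<le> e"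
      using zw g by (intro g3(2)) auto
  qed

  \<comment> \<open>With \<open>x\<close> proportional to \<alpha>, division by
    \<open>\<alpha> ^ 2\<close> leaves \<open>2 * pi * y \<le> B1 * \<alpha> + B0 * y * y\<close>,
    whose right side is below \<open>2 * y\<close>.\<close>
  define x where "x = \<alpha> * y"
  have x: "0 < x" "x \<le> 1" using \<alpha> y mult_le_one[of \<alpha> y] by (auto simp: x_def)
  define \<beta> where "\<beta> = cmod (of_real \<alpha> * \<kappa>)"
  have \<beta>: "\<alpha> \<le> \<beta>" "\<beta> \<le> 1"
    using \<kappa> \<alpha> mult_left_mono[of 1 "cmod \<kappa>" \<alpha>] mult_mono[of \<alpha> "1 / 2" "cmod \<kappa>" 2]
    by (auto simp: \<beta>_def norm_mult)
  have "2 * pi * \<beta> * x \<le> 5 / 4 * (2 * pi * (3 * e + e1) + pi * (2 * pi * \<alpha> ^ 3) * K * (1 + C2)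
      + x\<^sup>2 * (2 * pi * (2 * C1 * K + \<beta> + 1) + 10 * (2 * C1 * K)\<^sup>2))"
    using L.main_estimate[OF x] unfolding \<beta>_def C1_def C2_def .
  also have "\<dots> \<le> 5 / 4 * (2 * pi * (3 * e + e1) + pi * (2 * pi * \<alpha> ^ 3) * K * (1 + C2)
      + x\<^sup>2 * (2 * pi * (2 * C1 * K + 2) + 10 * (2 * C1 * K)\<^sup>2))"
  proof -
    have "2 * pi * (2 * C1 * K + \<beta> + 1) \<le> 2 * pi * (2 * C1 * K + 2)"
      using \<beta>(2) by (intro mult_left_mono) auto
    then have "x\<^sup>2 * (2 * pi * (2 * C1 * K + \<beta> + 1) + 10 * (2 * C1 * K)\<^sup>2)
        \<le> x\<^sup>2 * (2 * pi * (2 * C1 * K + 2) + 10 * (2 * C1 * K)\<^sup>2)"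
      by (rule mult_left_mono[OF add_right_mono]) simp
    then show ?thesis by (rule mult_left_mono[OF add_left_mono]) simp
  qed
  also have "\<dots> = B1 * \<alpha> ^ 3 + B0 * x\<^sup>2"
    unfolding B1_def B0_def e_def e1_def by (simp add: algebra_simps power2_eq_square)
  finally have "2 * pi * \<beta> * x \<le> B1 * \<alpha> ^ 3 + B0 * x\<^sup>2" .
  moreover have "2 * pi * \<alpha> * x \<le> 2 * pi * \<beta> * x"
    using \<beta> x by (intro mult_right_mono mult_left_mono) auto
  ultimately have "2 * pi * \<alpha> * x \<le> B1 * \<alpha> ^ 3 + B0 * x\<^sup>2" by linarith
  then have "\<alpha>\<^sup>2 * (2 * pi * y) \<le> \<alpha>\<^sup>2 * (B1 * \<alpha> + B0 * y * y)"
    by (simp add: x_def power2_eq_square power3_eq_cube algebra_simps)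
  then have "2 * pi * y \<le> B1 * \<alpha> + B0 * y * y" using \<alpha> by simp
  also have "\<dots> < y + 1 * y"
    using i y by (intro add_less_le_mono mult_right_mono) (auto simp: \<alpha>_def)
  finally have "2 * pi * y < 2 * y" by simp
  then show False using y(1) pi_gt3 by simp
qed

theorem theorem2:
  fixes q :: "nat \<Rightarrow> int"
  assumes "strict_mono q"
    and "\<forall>k. q k > 0"
    and "filterlim (\<lambda>k. real_of_int (q (Suc k)) / real_of_int (q k)) at_top sequentially"
  shows "\<not> menshov_spectrum ({n. n \<ge> 0} \<union> {- q k | k. True})"
proof
  assume menshov: "menshov_spectrum ({n. n \<ge> 0} \<union> {- q k | k. True})"
  define p where "p j = nat (q j)" for j
  have int_p: "int (p j) = q j" for j using assms(2) by (simp add: p_def less_imp_le)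
  have p_pos: "p j > 0" for j using assms(2) by (simp add: p_def)
  have p_mono: "strict_mono p"
    using assms(1,2) by (auto simp: strict_mono_def p_def)
  have growth: "\<exists>k0. \<forall>j\<ge>k0. C * real (p j) \<le> real (p (Suc j))" for C
  proof -
    have "eventually (\<lambda>k. C \<le> real_of_int (q (Suc k)) / real_of_int (q k)) sequentially"
      using assms(3) by (simp add: filterlim_at_top)
    moreover have "real (p j) = real_of_int (q j)" for j
      by (simp flip: int_p)
    moreover have "real_of_int (q j) > 0" for j using assms(2) by simp
    ultimately show ?thesis by (simp add: eventually_sequentially pos_le_divide_eq)
  qed
  obtain j0 where j0: "\<And>j. j0 \<le> j \<Longrightarrow> 4 * real (p j) \<le> real (p (Suc j))" using growth[of 4] by blast
  have lac: "4 * p j \<le> p (Suc j)" if "j0 \<le> j" for j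
    using j0[OF that] by linarith
  obtain k where k: "\<And>i j. k i \<le> j \<Longrightarrow> 1 / amp i ^ 6 * real (p j) \<le> real (p (Suc j))"
    using growth[of "1 / amp _ ^ 6"] by metis
  \<comment> \<open>Partial sums make \<open>n\<close> strictly increasing and place
    \<open>n i\<close> beyond \<open>j0\<close> and beyond the growth threshold
    \<open>k i\<close>.\<close>
  define n where "n i = j0 + (\<Sum>l\<le>i. Suc (k l))" for i
  have n_mono: "strict_mono n" by (simp add: strict_mono_Suc_iff n_def)
  have k_le: "k i \<le> n i" for i
    using member_le_sum[of i "{..i}" "\<lambda>l. Suc (k l)"] by (simp add: n_def)
  have n_grow: "real (p j) \<le> amp i ^ 6 * real (p (Suc j))" if "n i \<le> j" for i j
    using k[OF order_trans[OF k_le that]] zero_less_power[OF amp_pos[of i], of 6]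
    by (simp add: pos_divide_le_eq mult.commute)
  \<comment> \<open>This equals \<open>p (n i) / amp i ^ 3\<close>, a natural number because
    \<open>amp i\<close> is the reciprocal of a power of 2.\<close>
  define m where "m i = 2 ^ (4 ^ i * 3) * p (n i)" for i
  have m: "real (m i) * amp i ^ 3 = real (p (n i))" for i
    by (simp add: m_def amp_def power_divide flip: power_mult)
  have "witness m \<in> borel_measurable (lebesgue_on {0..2 * pi})"
    by (intro continuous_imp_measurable_on_sets_lebesgue continuous_on_subset[OF continuous_witness]) auto
  then obtain c where c_off: "\<And>n. n \<notin> {n. n \<ge> 0} \<union> {- q k | k. True} \<Longrightarrow> c n = 0"
    and conv: "AE t in lebesgue_on {0..2 * pi}.
      (\<lambda>N::nat. \<Sum>n\<in>{- int N..int N}. c n * exp (\<i> * of_int n * of_real t)) \<longlonglongrightarrow> witness m t"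
    using menshov unfolding menshov_spectrum_def by blast
  define a where "a j = c (int j)" for j
  \<comment> \<open>The value 0 at \<open>j = 0\<close> keeps the constant term from being counted
    twice.\<close>
  define b where "b j = (if j = 0 then 0 else c (- int j))" for j
  have S: "(\<Sum>n\<in>{- int N..int N}. c n * exp (\<i> * of_int n * of_real t)) = trig_sum a b N t" for N t
    unfolding sum_symmetric_interval trig_sum_def
    by (intro sum.cong refl) (auto simp: a_def b_def cis_conv_exp mult.assoc)
  have b_off: "b j = 0" if "j \<notin> range p" for j
  proof (cases "j = 0")
    case False
    have "- int j \<noteq> - q l" for l
      using that int_p[of l] by (auto simp flip: int_p)
    then show ?thesis using False c_off[of "- int j"] by (auto simp: b_def)
  qed (simp add: b_def)
  define Z where "Z = {t\<in>{0..2 * pi}. \<not> (\<lambda>N. trig_sum a b N t) \<longlonglongrightarrow> witness m t}"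
  have "negligible Z"
  proof -
    have "AE t in lebesgue. t \<in> {0..2 * pi} \<longrightarrow> (\<lambda>N. trig_sum a b N t) \<longlonglongrightarrow> witness m t"
      using conv by (simp add: S AE_restrict_space_iff)
    then obtain Y where "Y \<in> null_sets lebesgue"
      "{t. \<not> (t \<in> {0..2 * pi} \<longrightarrow> (\<lambda>N. trig_sum a b N t) \<longlonglongrightarrow> witness m t)} \<subseteq> Y"
      by (auto simp: eventually_ae_filter)
    then show ?thesis
      by (intro negligible_subset[of Y Z]) (auto simp: Z_def negligible_iff_null_sets)
  qed
  \<comment> \<open>Two consecutive periods cover \<open>[0, 9]\<close>, which leaves room for the
    shifts in the main argument.\<close>
  then have "negligible (Z \<union> (+) (2 * pi) ` Z)"
    by (intro negligible_Un negligible_translation)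
  moreover have "{t\<in>{0..9}. \<not> (\<lambda>N. trig_sum a b N t) \<longlonglongrightarrow> witness m t} \<subseteq> Z \<union> (+) (2 * pi) ` Z"
  proof
    fix t assume t: "t \<in> {t\<in>{0..9}. \<not> (\<lambda>N. trig_sum a b N t) \<longlonglongrightarrow> witness m t}"
    show "t \<in> Z \<union> (+) (2 * pi) ` Z"
    proof (cases "t \<le> 2 * pi")
      case True
      then show ?thesis using t by (auto simp: Z_def)
    next
      case False
      have "trig_sum a b N t = trig_sum a b N (t - 2 * pi)" "witness m t = witness m (t - 2 * pi)" for N
        using trig_sum_periodic[of a b N "t - 2 * pi"] witness_periodic[of m "t - 2 * pi"] by simp_all
      moreover have "t - 2 * pi \<in> {0..2 * pi}" using t False pi_gt3 by auto
      ultimately have "t - 2 * pi \<in> Z" using t by (simp add: Z_def)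
      then show ?thesis by (intro UnI2 image_eqI[of _ _ "t - 2 * pi"]) auto
    qed
  qed
  ultimately have "negligible {t\<in>{0..9}. \<not> (\<lambda>N. trig_sum a b N t) \<longlonglongrightarrow> witness m t}"
    by (rule negligible_subset)
  then show False
    by (intro no_representation[of j0 p b n m a, OF lac p_pos p_mono b_off _ n_mono n_grow m])
       (auto simp: n_def)
qed

end
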